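(* Let $X$ be a real vector space endowed with a topology $\mathcal{T}$. For $i\in\{0,1\}$ let $M_i$ be a linear (Hamel) basis of $X$ which is perfectly normal with respect to the subspace topology $\mathcal{T}\upharpoonright_{M_i}$ inherited from $\mathcal{T}$. Assume that for each $i\in\{0,1\}$, for every $\mathcal{T}\upharpoonright_{M_i}$-closed subset $A$ of $M_i$ and all $x\in M_i\setminus A$ there is a continuous linear functional $f:(X,\mathcal{T})\to\mathbb{R}$ such that $f(A)\subseteq\{0\}$ and $f(x)\neq 0$. Then $\dim M_0=\dim M_1$.
   Context: All vector spaces are over $\mathbb{R}$. The topology $\mathcal{T}$ on $X$ is an arbitrary topology; no compatibility with the vector space structure is assumed. $\mathcal{T}\upharpoonright_{M_i}$ denotes the subspace topology on $M_i$. For a normal topological space $Z$, $\dim Z$ denotes the Čech-Lebesgue covering dimension: $\dim Z\le n$ if every finite open cover of $Z$ has a finite open refinement of order at most $n$ (each point lies in at most $n+1$ members), and $\dim Z$ is the least such integer $n\ge -1$ (with $\dim Z=-1$ iff $Z=\emptyset$), or $\infty$ if no such $n$ exists. Each $M_i$ is considered with the topology $\mathcal{T}\upharpoonright_{M_i}$. *)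

theory Defs
  imports "HOL-Analysis.Analysis"
begin

text \<open>As with the library's \<^const>\<open>normal_space\<close>, no \<open>T\<^sub>1\<close> axiom is built in.\<close>

definition perfectly_normal_space :: "'a topology \<Rightarrow> bool" where
  "perfectly_normal_space Z \<longleftrightarrow>
     normal_space Z \<and> (\<forall>C. closedin Z C \<longrightarrow> gdelta_in Z C)"

definition finite_open_cover :: "'a topology \<Rightarrow> 'a set set \<Rightarrow> bool" where
  "finite_open_cover Z \<U> \<longleftrightarrow>
     finite \<U> \<and> (\<forall>U\<in>\<U>. openin Z U) \<and> \<Union>\<U> = topspace Z"

text \<open>The Cech-Lebesgue condition \<open>dim Z \<le> n\<close>. The parameter is an integer so that
  \<open>n = -1\<close> is allowed; it then says that no point lies in any member of the refinement.\<close>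

definition covering_dim_le :: "'a topology \<Rightarrow> int \<Rightarrow> bool" where
  "covering_dim_le Z n \<longleftrightarrow>
     (\<forall>\<U>. finite_open_cover Z \<U> \<longrightarrow>
       (\<exists>\<V>. finite_open_cover Z \<V> \<and> (\<forall>V\<in>\<V>. \<exists>U\<in>\<U>. V \<subseteq> U) \<and>
            (\<forall>x\<in>topspace Z. int (card {V\<in>\<V>. x \<in> V}) \<le> n + 1)))"

text \<open>The infimum is over a set of integers bounded below, so it is attained when the set is
  nonempty (see \<open>covering_dim_le_iff\<close> below); the infimum of the empty set is \<open>\<infinity>\<close>.\<close>

definition covering_dim :: "'a topology \<Rightarrow> ereal" where
  "covering_dim Z = (INF n\<in>{n::int. - 1 \<le> n \<and> covering_dim_le Z n}. ereal (real_of_int n))"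

lemma covering_dim_le_mono:
  assumes "covering_dim_le Z m" "m \<le> n"
  shows "covering_dim_le Z n"
  unfolding covering_dim_le_def
proof (intro allI impI)
  fix \<U> assume "finite_open_cover Z \<U>"
  then obtain \<V> where V: "finite_open_cover Z \<V>" "\<forall>V\<in>\<V>. \<exists>U\<in>\<U>. V \<subseteq> U"
      "\<forall>x\<in>topspace Z. int (card {V\<in>\<V>. x \<in> V}) \<le> m + 1"
    using assms(1) unfolding covering_dim_le_def by blast
  have "\<forall>x\<in>topspace Z. int (card {V\<in>\<V>. x \<in> V}) \<le> n + 1"
    using V(3) assms(2) by (meson add_right_mono order_trans)
  with V show "\<exists>\<V>. finite_open_cover Z \<V> \<and> (\<forall>V\<in>\<V>. \<exists>U\<in>\<U>. V \<subseteq> U) \<and>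
      (\<forall>x\<in>topspace Z. int (card {V\<in>\<V>. x \<in> V}) \<le> n + 1)"
    by blast
qed

lemma covering_dim_le_iff:
  assumes "- 1 \<le> n"
  shows "covering_dim Z \<le> ereal (real_of_int n) \<longleftrightarrow> covering_dim_le Z n"
proof
  assume "covering_dim_le Z n"
  then show "covering_dim Z \<le> ereal (real_of_int n)"
    unfolding covering_dim_def using assms by (intro INF_lower) auto
next
  assume "covering_dim Z \<le> ereal (real_of_int n)"
  also have "\<dots> < ereal (real_of_int n + 1)" by simp
  finally have "covering_dim Z < ereal (real_of_int n + 1)" .
  then obtain m where m: "covering_dim_le Z m" "ereal (real_of_int m) < ereal (real_of_int n + 1)"
    unfolding covering_dim_def INF_less_iff by blast
  then have "m \<le> n" by simp
  with m show "covering_dim_le Z n" by (blast intro: covering_dim_le_mono)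
qed

lemma covering_dim_le_minus_one_iff: "covering_dim_le Z (- 1) \<longleftrightarrow> topspace Z = {}"
proof
  assume L: "covering_dim_le Z (- 1)"
  have "finite_open_cover Z {topspace Z}" by (simp add: finite_open_cover_def)
  with L obtain \<V> where V: "finite_open_cover Z \<V>"
      "\<forall>x\<in>topspace Z. int (card {V\<in>\<V>. x \<in> V}) \<le> - 1 + 1"
    unfolding covering_dim_le_def by blast
  then have "\<forall>x\<in>topspace Z. {V\<in>\<V>. x \<in> V} = {}"
    by (auto simp: finite_open_cover_def)
  with V(1) show "topspace Z = {}"
    unfolding finite_open_cover_def by blast
next
  assume "topspace Z = {}"
  then show "covering_dim_le Z (- 1)"
    unfolding covering_dim_le_def finite_open_cover_def by (auto intro!: exI[of _ "{}"])
qed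

end

(* The coefficients of basis vectors give each x in one basis a finite support in the other, and the
   separating functionals make these supports lower semicontinuous in both directions; every y lies
   in the support of some x in its own support. In separable metrizable spaces such a pair of
   multivalued maps splits one space into countably many F-sigma pieces, each homeomorphic to a
   subset of the other, so the countable closed sum theorem and the subspace theorem compare the
   dimensions. In general one first passes to separable metrizable images of both bases, chosen by
   closing off a countable family of functions so that the supports descend and the dimension of the
   source does not go up (Mardesic factorization). *)

theory Submission
  imports Defs
begin

section \<open>Covers of perfectly normal spaces\<close>

text \<open>Perfect normality makes every open set the positivity set of one continuous function. A
  condition such as \<open>R y\<close> meeting a given box, which lower semicontinuity makes open,
  is therefore stored in a single coordinate, and countably many coordinates suffice for the
  multivalued maps to descend. The passage to separable metrizable images is forced by counting:
  pieces are indexed by pairs of basic open sets, one isolating x in the support of y and one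
  isolating y in the support of x, and second countability leaves only countably many pairs. One
  finite cover of the target is treated at a time: by construction only the image of the source has
  bounded dimension, the bound for the image of the target is inferred from it, and a refinement
  found there is lifted back. No T1 axiom is assumed, so distinct basis vectors may be
  indistinguishable; coefficients are then summed over classes, and supports are finite only up to
  an identification that disappears in the metrizable images.\<close>

text \<open>Members of a refinement are grouped by a chosen \<open>U i\<close> containing them. A
  point of \<open>W i\<close> lies in some member assigned to \<open>i\<close>, so grouping cannot
  raise the order. Counting indices instead of sets keeps later counts stable under intersections
  and preimages.\<close>

lemma covering_dim_leE:
  assumes "covering_dim_le Z n" and I: "finite I" and U: "\<And>i. i \<in> I \<Longrightarrow> openin Z (U i)"
    and cov: "topspace Z \<subseteq> (\<Union>i\<in>I. U i)"
  obtains W where "\<And>i. i \<in> I \<Longrightarrow> openin Z (W i)" "\<And>i. i \<in> I \<Longrightarrow> W i \<subseteq> U i"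
    "topspace Z \<subseteq> (\<Union>i\<in>I. W i)"
    "\<And>x. x \<in> topspace Z \<Longrightarrow> int (card {i \<in> I. x \<in> W i}) \<le> n + 1"
proof -
  have "finite_open_cover Z (U ` I)"
    unfolding finite_open_cover_def
    by (intro conjI equalityI cov Sup_least) (use I U openin_subset[OF U] in auto)
  then obtain \<V> where V: "finite_open_cover Z \<V>" "\<forall>V\<in>\<V>. \<exists>W\<in>U ` I. V \<subseteq> W"
      "\<forall>x\<in>topspace Z. int (card {V\<in>\<V>. x \<in> V}) \<le> n + 1"
    using assms(1) unfolding covering_dim_le_def by blast
  then have "\<forall>V\<in>\<V>. \<exists>i. i \<in> I \<and> V \<subseteq> U i" by fast
  from bchoice[OF this] obtain c where c: "\<And>V. V \<in> \<V> \<Longrightarrow> c V \<in> I \<and> V \<subseteq> U (c V)"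
    by blast
  define W where "W i = \<Union>{V\<in>\<V>. c V = i}" for i
  show thesis
  proof
    show "openin Z (W i)" for i
      using V(1) by (auto simp: W_def finite_open_cover_def)
    show "W i \<subseteq> U i" for i
      using c by (auto simp: W_def)
    show "topspace Z \<subseteq> (\<Union>i\<in>I. W i)"
    proof
      fix x assume "x \<in> topspace Z"
      then obtain V where "V \<in> \<V>" "x \<in> V" using V(1) by (auto simp: finite_open_cover_def)
      then show "x \<in> (\<Union>i\<in>I. W i)" using c[of V] by (auto simp: W_def)
    qed
    fix x assume x: "x \<in> topspace Z"
    have fin: "finite {V\<in>\<V>. x \<in> V}" using V(1) by (auto simp: finite_open_cover_def)
    have "{i \<in> I. x \<in> W i} \<subseteq> c ` {V\<in>\<V>. x \<in> V}"
      by (auto simp: W_def)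
    then have "card {i \<in> I. x \<in> W i} \<le> card {V\<in>\<V>. x \<in> V}"
      by (rule order_trans[OF card_mono[OF finite_imageI[OF fin]] card_image_le[OF fin]])
    then show "int (card {i \<in> I. x \<in> W i}) \<le> n + 1"
      using V(3) x by fastforce
  qed
qed

text \<open>Repeated sets of an indexed family collapse in its image, so counting indices bounds
  counting members. The free index type allows indexing by the cover itself or by natural
  numbers.\<close>

lemma covering_dim_leI:
  fixes Z :: "'a topology"
  assumes "\<And>\<U>. \<lbrakk>finite \<U>; \<And>U. U \<in> \<U> \<Longrightarrow> openin Z U; topspace Z \<subseteq> \<Union>\<U>\<rbrakk> \<Longrightarrow>
    \<exists>(J::'j set) W. finite J \<and> (\<forall>j\<in>J. openin Z (W j) \<and> (\<exists>U\<in>\<U>. W j \<subseteq> U)) \<and>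
      topspace Z \<subseteq> (\<Union>j\<in>J. W j) \<and> (\<forall>x\<in>topspace Z. int (card {j\<in>J. x \<in> W j}) \<le> n + 1)"
  shows "covering_dim_le Z n"
  unfolding covering_dim_le_def
proof (intro allI impI)
  fix \<U> assume U: "finite_open_cover Z \<U>"
  have "\<exists>(J::'j set) W. finite J \<and> (\<forall>j\<in>J. openin Z (W j) \<and> (\<exists>U\<in>\<U>. W j \<subseteq> U)) \<and>
      topspace Z \<subseteq> (\<Union>j\<in>J. W j) \<and> (\<forall>x\<in>topspace Z. int (card {j\<in>J. x \<in> W j}) \<le> n + 1)"
    by (rule assms) (use U in \<open>auto simp: finite_open_cover_def\<close>)
  then obtain J W where J: "finite (J::'j set)"
    and W': "\<forall>j\<in>J. openin Z (W j) \<and> (\<exists>U\<in>\<U>. W j \<subseteq> U)"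
    and cov: "topspace Z \<subseteq> (\<Union>j\<in>J. W j)"
    and ord: "\<forall>x\<in>topspace Z. int (card {j\<in>J. x \<in> W j}) \<le> n + 1"
    by (elim exE conjE)
  have W: "\<And>j. j\<in>J \<Longrightarrow> openin Z (W j)" "\<And>j. j\<in>J \<Longrightarrow> \<exists>U\<in>\<U>. W j \<subseteq> U"
    using W' by blast+
  show "\<exists>\<V>. finite_open_cover Z \<V> \<and> (\<forall>V\<in>\<V>. \<exists>U\<in>\<U>. V \<subseteq> U) \<and>
            (\<forall>x\<in>topspace Z. int (card {V\<in>\<V>. x \<in> V}) \<le> n + 1)"
  proof (intro exI conjI ballI)
    show "finite_open_cover Z (W ` J)"
      unfolding finite_open_cover_def
      by (intro conjI equalityI cov Sup_least) (use J W(1) openin_subset[OF W(1)] in auto)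
    show "\<exists>U\<in>\<U>. V \<subseteq> U" if "V \<in> W ` J" for V
      using that W by auto
    fix x assume x: "x \<in> topspace Z"
    have "{V\<in>W ` J. x \<in> V} = W ` {j\<in>J. x \<in> W j}"
      by auto
    then have "card {V\<in>W ` J. x \<in> V} \<le> card {j\<in>J. x \<in> W j}"
      using J by (simp add: card_image_le)
    then show "int (card {V\<in>W ` J. x \<in> V}) \<le> n + 1"
      using bspec[OF ord x] by linarith
  qed
qed

text \<open>The complement of \<open>U\<close> is the intersection of open sets \<open>G n\<close>.
  Urysohn functions that vanish off \<open>U\<close> and equal 1 off \<open>G n\<close> are summed
  with geometric weights; each point of \<open>U\<close> lies outside some \<open>G n\<close>, so
  the sum is positive exactly on \<open>U\<close>.\<close>

lemma perfectly_normal_cozero: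
  assumes "perfectly_normal_space Z" "openin Z U"
  obtains u where "continuous_map Z euclideanreal u" "\<And>x. 0 \<le> u x" "\<And>x. u x \<le> 1"
    "\<And>x. x \<in> topspace Z \<Longrightarrow> 0 < u x \<longleftrightarrow> x \<in> U"
proof -
  have nZ: "normal_space Z" using assms(1) by (simp add: perfectly_normal_space_def)
  have C: "closedin Z (topspace Z - U)" using assms(2) by blast
  then have "gdelta_in Z (topspace Z - U)"
    using assms(1) by (simp add: perfectly_normal_space_def)
  then obtain G where G: "\<And>n::nat. openin Z (G n)" "\<Inter>(range G) = topspace Z - U"
    unfolding gdelta_in_descending by blast
  have "\<exists>f. continuous_map Z (top_of_set {0..1::real}) f \<and> f ` (topspace Z - U) \<subseteq> {0} \<and> f ` (topspace Z - G n) \<subseteq> {1}" for n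
  proof -
    have "closedin Z (topspace Z - G n)" using G by blast
    moreover have "disjnt (topspace Z - U) (topspace Z - G n)" using G(2) by (auto simp: disjnt_def)
    ultimately show ?thesis using Urysohn_lemma[OF nZ C, of "topspace Z - G n" 0 1] by (metis zero_le_one)
  qed
  then obtain f where f: "\<And>n. continuous_map Z (top_of_set {0..1::real}) (f n)"
      "\<And>n. f n ` (topspace Z - U) \<subseteq> {0}" "\<And>n. f n ` (topspace Z - G n) \<subseteq> {1}"
    by metis
  have fc: "continuous_map Z euclideanreal (f n)" and f01: "x \<in> topspace Z \<Longrightarrow> f n x \<in> {0..1}" for n x
    using f(1)[of n] by (auto simp: continuous_map_in_subtopology)
  define w where "w x = (\<Sum>n. (1/2)^n * f n x)" for x
  have smb: "summable (\<lambda>n. (1/2)^n * f n x)" if "x \<in> topspace Z" for x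
    by (rule summable_comparison_test'[of "\<lambda>n. (1/2::real)^n"])
       (use f01[OF that] in \<open>auto simp: abs_mult\<close>)
  have wc: "continuous_map Z euclideanreal w"
  proof -
    have uni: "uniform_limit (topspace Z) (\<lambda>N x. \<Sum>n<N. (1/2)^n * f n x) w sequentially"
      unfolding w_def
      by (rule Weierstrass_m_test[where M = "\<lambda>n. (1/2)^n"]) (use f01 in \<open>auto simp: abs_mult\<close>)
    have "continuous_map Z (Met_TC.mtopology) w"
    proof (rule Met_TC.continuous_map_uniform_limit)
      show "\<forall>\<^sub>F N in sequentially. continuous_map Z Met_TC.mtopology (\<lambda>x. \<Sum>n<N. (1/2)^n * f n x)"
        by (intro always_eventually allI) (auto intro!: continuous_intros fc)
      show "\<forall>\<^sub>F N in sequentially. \<forall>x\<in>topspace Z. w x \<in> UNIV \<and> dist (\<Sum>n<N. (1/2)^n * f n x) (w x) < e" if "0 < e" for e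
        using uniform_limitD[OF uni that] by simp
    qed simp
    then show ?thesis by simp
  qed
  have wpos: "0 < w x \<longleftrightarrow> x \<in> U" if x: "x \<in> topspace Z" for x
  proof
    assume "x \<in> U"
    then obtain n where "x \<notin> G n" using G(2) x by blast
    then have "f n x = 1" using f(3)[of n] x by auto
    then have "0 < (1/2)^n * f n x" by simp
    then show "0 < w x" unfolding w_def
      using suminf_pos2[OF smb[OF x], of n] f01[OF x] by auto
  next
    assume "0 < w x"
    show "x \<in> U"
    proof (rule ccontr)
      assume "x \<notin> U"
      then have "f n x = 0" for n using f(2)[of n] x by auto
      then have "w x = 0" by (simp add: w_def)
      with \<open>0 < w x\<close> show False by simp
    qed
  qed
  show thesis
  proof
    \<comment> \<open>Nothing is known of \<open>w\<close> off the carrier; the clamp gives the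
      bounds at every point of the type without changing where the function is positive.\<close>
    show "continuous_map Z euclideanreal (\<lambda>x. min 1 (max 0 (w x)))"
      by (intro continuous_intros wc)
  qed (use wpos in \<open>auto simp: min_less_iff_conj less_max_iff_disj\<close>)
qed

text \<open>Instead of a sum equal to 1, some function attains 1 at each point. This is a closed
  condition, so it survives the passage to a closure in the Hilbert cube.\<close>

lemma subordinate_functions:
  assumes "perfectly_normal_space Z" and I: "finite I" and U: "\<And>i. i \<in> I \<Longrightarrow> openin Z (U i)"
    and cov: "topspace Z \<subseteq> (\<Union>i\<in>I. U i)"
  obtains b :: "'i \<Rightarrow> 'a \<Rightarrow> real"
  where "\<And>i. i \<in> I \<Longrightarrow> continuous_map Z euclideanreal (b i)"
    "\<And>i x. i \<in> I \<Longrightarrow> x \<in> topspace Z \<Longrightarrow> 0 \<le> b i x \<and> b i x \<le> 1 \<and> (0 < b i x \<longleftrightarrow> x \<in> U i)"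
    "\<And>x. x \<in> topspace Z \<Longrightarrow> \<exists>i\<in>I. b i x = 1"
proof -
  have "\<exists>u. continuous_map Z euclideanreal u \<and> (\<forall>x. 0 \<le> u x) \<and> (\<forall>x\<in>topspace Z. 0 < u x \<longleftrightarrow> x \<in> U i)"
    if "i \<in> I" for i
    using perfectly_normal_cozero[OF assms(1) U[OF that]] by metis
  then obtain u where uc: "\<And>i. i \<in> I \<Longrightarrow> continuous_map Z euclideanreal (u i)"
    and u0: "\<And>i x. i \<in> I \<Longrightarrow> 0 \<le> u i x"
    and up: "\<And>i x. i \<in> I \<Longrightarrow> x \<in> topspace Z \<Longrightarrow> 0 < u i x \<longleftrightarrow> x \<in> U i"
    by metis
  define s where "s x = (\<Sum>i\<in>I. u i x)" for x
  have s: "0 < s x" if x: "x \<in> topspace Z" for x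
  proof -
    obtain i where i: "i \<in> I" "x \<in> U i" using cov x by blast
    then show ?thesis unfolding s_def using up[OF i(1) x]
      by (intro sum_pos2[OF I i(1)]) (auto simp: u0)
  qed
  \<comment> \<open>Some \<open>u i x\<close> is at least the average \<open>s x / card I\<close>;
    scaled this way it reaches 1, and truncation keeps it there.\<close>
  define b where "b i x = min 1 (card I * u i x / s x)" for i x
  show thesis
  proof
    have "continuous_map Z euclideanreal s"
      unfolding s_def by (intro continuous_intros I uc)
    then show "continuous_map Z euclideanreal (b i)" if "i \<in> I" for i
      unfolding b_def using s
      by (intro continuous_intros uc that) force+
    fix x assume x: "x \<in> topspace Z"
    have "I \<noteq> {}" using x cov by auto
    then have cI: "0 < card I" using I by (simp add: card_gt_0_iff)
    show "0 \<le> b i x \<and> b i x \<le> 1 \<and> (0 < b i x \<longleftrightarrow> x \<in> U i)" if i: "i \<in> I" for i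
      using s[OF x] up[OF i x] u0[OF i, of x] cI by (auto simp: b_def zero_less_mult_iff zero_less_divide_iff)
    show "\<exists>i\<in>I. b i x = 1"
    proof (rule ccontr)
      assume "\<not> ?thesis"
      then have "card I * u i x < s x" if "i \<in> I" for i
        using that s[OF x] by (force simp: b_def min_def field_simps split: if_splits)
      then have "(\<Sum>i\<in>I. card I * u i x) < (\<Sum>i\<in>I. s x)"
        by (intro sum_strict_mono I \<open>I \<noteq> {}\<close>)
      then show False by (simp add: s_def flip: sum_distrib_left)
    qed
  qed
qed

lemma open_cover_shrink:
  assumes "perfectly_normal_space Z" "finite I" "\<And>i. i \<in> I \<Longrightarrow> openin Z (U i)"
    and "topspace Z \<subseteq> (\<Union>i\<in>I. U i)"
  obtains W C where "\<And>i. i \<in> I \<Longrightarrow> openin Z (W i)" "\<And>i. i \<in> I \<Longrightarrow> closedin Z (C i)"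
    "\<And>i. i \<in> I \<Longrightarrow> W i \<subseteq> C i" "\<And>i. i \<in> I \<Longrightarrow> C i \<subseteq> U i" "topspace Z \<subseteq> (\<Union>i\<in>I. W i)"
proof -
  obtain b where b: "\<And>i. i \<in> I \<Longrightarrow> continuous_map Z euclideanreal (b i)"
    "\<And>i x. i \<in> I \<Longrightarrow> x \<in> topspace Z \<Longrightarrow> 0 \<le> b i x \<and> b i x \<le> 1 \<and> (0 < b i x \<longleftrightarrow> x \<in> U i)"
    "\<And>x. x \<in> topspace Z \<Longrightarrow> \<exists>i\<in>I. b i x = (1::real)"
    using subordinate_functions[OF assms] by metis
  show thesis
  proof
    show "openin Z {x \<in> topspace Z. b i x \<in> {1/2<..}}" if "i \<in> I" for i
      using openin_continuous_map_preimage[OF b(1)[OF that], of "{1/2<..}"] by simp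
    show "closedin Z {x \<in> topspace Z. b i x \<in> {1/2..}}" if "i \<in> I" for i
      using closedin_continuous_map_preimage[OF b(1)[OF that], of "{1/2..}"] by simp
    show "{x \<in> topspace Z. b i x \<in> {1/2..}} \<subseteq> U i" if "i \<in> I" for i
      using b(2)[OF that] by force
    show "topspace Z \<subseteq> (\<Union>i\<in>I. {x \<in> topspace Z. b i x \<in> {1/2<..}})"
      using b(3) by fastforce
  qed auto
qed

text \<open>With \<open>d i\<close> vanishing exactly on \<open>H i\<close>, let \<open>V j\<close>
  consist of the points where at most \<open>m\<close> indices \<open>i\<close> satisfy
  \<open>d i x \<le> d j x\<close>. On \<open>H j\<close> these indices are just those with
  \<open>x\<close> in \<open>H i\<close>. If \<open>x\<close> lies in several \<open>V j\<close>,
  the one with the largest \<open>d j x\<close> counts all the others, so there are at most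
  \<open>m\<close>.\<close>

lemma closed_family_swell:
  assumes "perfectly_normal_space Z" and I: "finite I" and H: "\<And>i. i \<in> I \<Longrightarrow> closedin Z (H i)"
    and ord: "\<And>x. x \<in> topspace Z \<Longrightarrow> int (card {i \<in> I. x \<in> H i}) \<le> m"
  obtains V where "\<And>i. i \<in> I \<Longrightarrow> openin Z (V i)" "\<And>i. i \<in> I \<Longrightarrow> H i \<subseteq> V i"
    "\<And>x. x \<in> topspace Z \<Longrightarrow> int (card {i \<in> I. x \<in> V i}) \<le> m"
proof -
  have "\<exists>d. continuous_map Z euclideanreal d \<and> (\<forall>x. 0 \<le> d x) \<and> (\<forall>x\<in>topspace Z. d x = 0 \<longleftrightarrow> x \<in> H i)"
    if i: "i \<in> I" for i
  proof -
    have "openin Z (topspace Z - H i)" using H[OF i] by blast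
    then obtain u where "continuous_map Z euclideanreal u" "\<And>x. 0 \<le> u x" "\<And>x. u x \<le> 1"
      "\<And>x. x \<in> topspace Z \<Longrightarrow> 0 < u x \<longleftrightarrow> x \<in> topspace Z - H i"
      by (rule perfectly_normal_cozero[OF assms(1)]) (rule that; assumption)
    then show ?thesis by (intro exI[of _ u]) (auto simp: less_le)
  qed
  then obtain d where d: "\<And>i. i \<in> I \<Longrightarrow> continuous_map Z euclideanreal (d i)"
    "\<And>i x. i \<in> I \<Longrightarrow> 0 \<le> d i x" "\<And>i x. i \<in> I \<Longrightarrow> x\<in>topspace Z \<Longrightarrow> d i x = 0 \<longleftrightarrow> x \<in> H i"
    by metis
  define L where "L j x = {i \<in> I. d i x \<le> d j x}" for j x
  define V where "V j = {x \<in> topspace Z. int (card (L j x)) \<le> m}" for j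
  show thesis
  proof
    fix j assume j: "j \<in> I"
    have "topspace Z - V j = (\<Union>J\<in>{J. J \<subseteq> I \<and> m < int (card J)}. {x\<in>topspace Z. \<forall>i\<in>J. d i x \<le> d j x})"
      (is "_ = ?R")
    proof (intro equalityI subsetI)
      fix x assume "x \<in> topspace Z - V j"
      then show "x \<in> ?R"
        by (intro UN_I[of "L j x"]) (auto simp: V_def L_def)
    next
      fix x assume "x \<in> ?R"
      then obtain J where J: "J \<subseteq> I" "m < int (card J)" "x \<in> topspace Z" "\<forall>i\<in>J. d i x \<le> d j x" by auto
      then have "card J \<le> card (L j x)" using I by (intro card_mono) (auto simp: L_def)
      with J show "x \<in> topspace Z - V j" by (auto simp: V_def)
    qed
    moreover have "closedin Z ?R"
    proof (rule closedin_Union)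
      show "finite ((\<lambda>J. {x\<in>topspace Z. \<forall>i\<in>J. d i x \<le> d j x}) ` {J. J \<subseteq> I \<and> m < int (card J)})"
        using I by auto
      fix S assume "S \<in> (\<lambda>J. {x\<in>topspace Z. \<forall>i\<in>J. d i x \<le> d j x}) ` {J. J \<subseteq> I \<and> m < int (card J)}"
      then obtain J where J: "J \<subseteq> I" and S: "S = {x\<in>topspace Z. \<forall>i\<in>J. d i x \<le> d j x}" by auto
      have "closedin Z {x\<in>topspace Z. d i x - d j x \<in> {..0}}" if "i \<in> J" for i
        using J that j d(1) by (intro closedin_continuous_map_preimage[of Z euclideanreal] continuous_intros) auto
      then have "closedin Z (\<Inter>(insert (topspace Z) ((\<lambda>i. {x\<in>topspace Z. d i x - d j x \<in> {..0}}) ` J)))"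
        by (intro closedin_Inter) auto
      moreover have "S = \<Inter>(insert (topspace Z) ((\<lambda>i. {x\<in>topspace Z. d i x - d j x \<in> {..0}}) ` J))"
        by (auto simp: S)
      ultimately show "closedin Z S" by simp
    qed
    ultimately have "closedin Z (topspace Z - V j)" by simp
    then show "openin Z (V j)" unfolding openin_closedin_eq by (auto simp: V_def)
    show "H j \<subseteq> V j"
    proof
      fix x assume x: "x \<in> H j"
      then have xZ: "x \<in> topspace Z" using H[OF j] closedin_subset by blast
      have "d i x \<le> d j x \<longleftrightarrow> x \<in> H i" if "i \<in> I" for i
        using d(2)[OF that, of x] d(3)[OF that xZ] d(3)[OF j xZ] x by auto
      then have "L j x = {i \<in> I. x \<in> H i}"
        by (auto simp: L_def)
      then show "x \<in> V j" using ord[OF xZ] xZ by (simp add: V_def)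
    qed
  next
    fix x assume x: "x \<in> topspace Z"
    let ?J = "{i \<in> I. x \<in> V i}"
    show "int (card ?J) \<le> m"
    proof (cases "?J = {}")
      \<comment> \<open>As \<open>m\<close> is an integer, its nonnegativity has to be extracted
        from \<open>ord\<close> at this point.\<close>
      case True
      then have "card ?J = 0" by (metis card.empty)
      then show ?thesis using ord[OF x] by linarith
    next
      case False
      have finJ: "finite ?J" using I by simp
      obtain j where j: "j \<in> ?J" and jm: "\<And>i. i \<in> ?J \<Longrightarrow> d i x \<le> d j x"
      proof -
        have "Max ((\<lambda>i. d i x) ` ?J) \<in> (\<lambda>i. d i x) ` ?J" using False finJ by (intro Max_in) auto
        then obtain j where "j \<in> ?J" "d j x = Max ((\<lambda>i. d i x) ` ?J)" by auto
        with that show ?thesis using finJ by (metis (no_types, lifting) Max_ge finite_imageI imageI)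
      qed
      have "card ?J \<le> card (L j x)" using I jm by (intro card_mono) (auto simp: L_def)
      also have "int (card (L j x)) \<le> m" using j by (simp add: V_def)
      finally show ?thesis by simp
    qed
  qed
qed

section \<open>The countable closed sum theorem\<close>

text \<open>A shrinking \<open>G\<close> of the trace on \<open>F\<close> extends to
  \<open>Z\<close> by adding \<open>U i - F\<close>: the result is open because \<open>F\<close> is
  closed, still covers, and meets \<open>F\<close> only in \<open>G i\<close>. Shrinking once more
  to closed sets cannot raise the order on \<open>F\<close>.\<close>

lemma open_cover_shrink_order_on_closed:
  assumes pn: "perfectly_normal_space Z" and F: "closedin Z F"
    and dim: "covering_dim_le (subtopology Z F) n"
    and I: "finite I" and U: "\<And>i. i \<in> I \<Longrightarrow> openin Z (U i)" and cov: "topspace Z \<subseteq> (\<Union>i\<in>I. U i)"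
  obtains W C where "\<And>i. i \<in> I \<Longrightarrow> openin Z (W i)" "\<And>i. i \<in> I \<Longrightarrow> closedin Z (C i)"
    "\<And>i. i \<in> I \<Longrightarrow> W i \<subseteq> C i" "\<And>i. i \<in> I \<Longrightarrow> C i \<subseteq> U i" "topspace Z \<subseteq> (\<Union>i\<in>I. W i)"
    "\<And>x. x \<in> F \<Longrightarrow> int (card {i \<in> I. x \<in> C i}) \<le> n + 1"
proof -
  have FZ: "F \<subseteq> topspace Z" using F by (rule closedin_subset)
  then have tF: "topspace (subtopology Z F) = F" by auto
  have op: "openin (subtopology Z F) (F \<inter> U i)" if "i \<in> I" for i
    using U[OF that] by (simp add: openin_subtopology_Int2)
  have cov': "topspace (subtopology Z F) \<subseteq> (\<Union>i\<in>I. F \<inter> U i)"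
    using cov by auto
  obtain G where G: "\<And>i. i \<in> I \<Longrightarrow> openin (subtopology Z F) (G i)" "\<And>i. i \<in> I \<Longrightarrow> G i \<subseteq> F \<inter> U i"
    "F \<subseteq> (\<Union>i\<in>I. G i)" "\<And>x. x \<in> F \<Longrightarrow> int (card {i \<in> I. x \<in> G i}) \<le> n + 1"
    by (rule covering_dim_leE[OF dim I op cov', unfolded tF]) (assumption, (rule that; assumption))
  define V where "V i = (U i - F) \<union> G i" for i
  have "openin Z (V i)" if i: "i \<in> I" for i
  proof -
    obtain O' where O': "openin Z O'" "G i = O' \<inter> F"
      using G(1)[OF i] by (auto simp: openin_subtopology)
    have "V i = (U i - F) \<union> (U i \<inter> O')"
      using O' G(2)[OF i] by (auto simp: V_def)
    then show ?thesis using U[OF i] F O' by auto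
  qed
  moreover have "topspace Z \<subseteq> (\<Union>i\<in>I. V i)"
  proof
    fix x assume "x \<in> topspace Z"
    then show "x \<in> (\<Union>i\<in>I. V i)"
      using cov G(3) by (cases "x \<in> F") (auto simp: V_def)
  qed
  ultimately obtain W C where W: "\<And>i. i \<in> I \<Longrightarrow> openin Z (W i)" "\<And>i. i \<in> I \<Longrightarrow> closedin Z (C i)"
    "\<And>i. i \<in> I \<Longrightarrow> W i \<subseteq> C i" "\<And>i. i \<in> I \<Longrightarrow> C i \<subseteq> V i" "topspace Z \<subseteq> (\<Union>i\<in>I. W i)"
    using open_cover_shrink[OF pn I, of V] by metis
  show thesis
  proof (rule that[of W C])
    show "C i \<subseteq> U i" if "i \<in> I" for i
      using W(4)[OF that] G(2)[OF that] by (auto simp: V_def)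
    fix x assume x: "x \<in> F"
    have "card {i \<in> I. x \<in> C i} \<le> card {i \<in> I. x \<in> G i}"
      using W(4) x I by (intro card_mono) (auto simp: V_def)
    then show "int (card {i \<in> I. x \<in> C i}) \<le> n + 1"
      using G(4)[OF x] by linarith
  qed (use W in auto)
qed

text \<open>Stage by stage the cover is shrunk so that its order is right on one more
  \<open>F k\<close>. The intersections of the closed shrinkings have the right order everywhere and
  are finally swollen back to open sets.\<close>

theorem covering_dim_le_countable_closed_Union:
  fixes F :: "nat \<Rightarrow> 'a set"
  assumes pn: "perfectly_normal_space Z" and F: "\<And>k. closedin Z (F k)"
    and dim: "\<And>k. covering_dim_le (subtopology Z (F k)) n" and cov: "topspace Z \<subseteq> (\<Union>k. F k)"
  shows "covering_dim_le Z n"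
proof (rule covering_dim_leI)
  fix \<U> assume fin: "finite \<U>" and op: "\<And>U. U \<in> \<U> \<Longrightarrow> openin Z U" and covU: "topspace Z \<subseteq> \<Union>\<U>"
  \<comment> \<open>A state carries an open and a closed shrinking: the open one is the cover to be
    shrunk next, the closed ones have closed intersections.\<close>
  define P :: "('a set \<Rightarrow> 'a set) \<times> ('a set \<Rightarrow> 'a set) \<Rightarrow> bool" where "P = (\<lambda>s. (\<forall>U\<in>\<U>. openin Z (fst s U) \<and> closedin Z (snd s U) \<and> fst s U \<subseteq> snd s U \<and> snd s U \<subseteq> U)
    \<and> topspace Z \<subseteq> (\<Union>U\<in>\<U>. fst s U))"
  define Q :: "nat \<Rightarrow> ('a set \<Rightarrow> 'a set) \<times> ('a set \<Rightarrow> 'a set) \<Rightarrow> ('a set \<Rightarrow> 'a set) \<times> ('a set \<Rightarrow> 'a set) \<Rightarrow> bool"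
    where "Q = (\<lambda>k s t. (\<forall>U\<in>\<U>. snd t U \<subseteq> fst s U) \<and>
    (\<forall>x\<in>F k. int (card {U\<in>\<U>. x \<in> snd t U}) \<le> n + 1))"
  have "\<exists>f. \<forall>k. P (f k) \<and> Q k (f k) (f (Suc k))"
  proof (rule dependent_nat_choice)
    have "topspace Z \<subseteq> (\<Union>U\<in>\<U>. U)" using covU by simp
    then obtain W C where "\<And>U. U \<in> \<U> \<Longrightarrow> openin Z (W U)" "\<And>U. U \<in> \<U> \<Longrightarrow> closedin Z (C U)"
      "\<And>U. U \<in> \<U> \<Longrightarrow> W U \<subseteq> C U" "\<And>U. U \<in> \<U> \<Longrightarrow> C U \<subseteq> U" "topspace Z \<subseteq> (\<Union>U\<in>\<U>. W U)"
      using open_cover_shrink[OF pn fin, of "\<lambda>U. U"] op by metis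
    then show "\<exists>s. P s" by (intro exI[of _ "(W, C)"]) (auto simp: P_def)
  next
    fix s k assume s: "P s"
    have s': "openin Z (fst s U)" if "U \<in> \<U>" for U using s that by (auto simp: P_def)
    have cov': "topspace Z \<subseteq> (\<Union>U\<in>\<U>. fst s U)" using s by (auto simp: P_def)
    obtain W C where W: "\<And>U. U \<in> \<U> \<Longrightarrow> openin Z (W U)" "\<And>U. U \<in> \<U> \<Longrightarrow> closedin Z (C U)"
      "\<And>U. U \<in> \<U> \<Longrightarrow> W U \<subseteq> C U" "\<And>U. U \<in> \<U> \<Longrightarrow> C U \<subseteq> fst s U" "topspace Z \<subseteq> (\<Union>U\<in>\<U>. W U)"
      "\<And>x. x \<in> F k \<Longrightarrow> int (card {U \<in> \<U>. x \<in> C U}) \<le> n + 1"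
      by (rule open_cover_shrink_order_on_closed[OF pn F dim fin s' cov'])
        (assumption, (rule that; assumption))
    have "C U \<subseteq> U" if "U \<in> \<U>" for U using W(4)[OF that] s that by (fastforce simp: P_def)
    with W show "\<exists>t. P t \<and> Q k s t"
      by (intro exI[of _ "(W, C)"]) (simp add: P_def Q_def)
  qed
  then obtain f where f: "\<And>k. P (f k)" "\<And>k. Q k (f k) (f (Suc k))" by blast
  define C where "C k = snd (f k)" for k
  have Ccl: "closedin Z (C k U)" and CU: "C k U \<subseteq> U" if "U \<in> \<U>" for k U
    using f(1)[of k] that by (auto simp: P_def C_def)
  have Cdec: "C (Suc k) U \<subseteq> C k U" if "U \<in> \<U>" for k U
    using f(1)[of k] f(2)[of k] that by (fastforce simp: P_def Q_def C_def)
  have Cmono: "C l U \<subseteq> C k U" if "U \<in> \<U>" "k \<le> l" for k l U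
    by (rule lift_Suc_antimono_le[of "\<lambda>k. C k U", OF _ that(2)]) (use Cdec that(1) in auto)
  have Ccov: "topspace Z \<subseteq> (\<Union>U\<in>\<U>. C k U)" for k
    using f(1)[of k] by (fastforce simp: P_def C_def)
  define H where "H U = (\<Inter>k. C k U)" for U
  have Hcl: "closedin Z (H U)" if "U \<in> \<U>" for U
    unfolding H_def using Ccl that by blast
  \<comment> \<open>A point missed by every intersection is missed by each of the finitely many
    decreasing sequences from some stage on. The sum of these stages is a common upper bound,
    contradicting that every stage covers.\<close>
  have Hcov: "\<exists>U\<in>\<U>. x \<in> H U" if x: "x \<in> topspace Z" for x
  proof (rule ccontr)
    assume "\<not> ?thesis"
    then have "\<forall>U\<in>\<U>. \<exists>k. x \<notin> C k U" by (auto simp: H_def)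
    then obtain k where k: "\<And>U. U \<in> \<U> \<Longrightarrow> x \<notin> C (k U) U" by metis
    obtain U where U: "U \<in> \<U>" "x \<in> C (\<Sum>U\<in>\<U>. k U) U" using Ccov x by blast
    have "k U \<le> (\<Sum>U\<in>\<U>. k U)" using fin U(1) by (intro member_le_sum) auto
    then show False using Cmono[OF U(1)] k[OF U(1)] U(2) by blast
  qed
  have Hord: "int (card {U\<in>\<U>. x \<in> H U}) \<le> n + 1" if x: "x \<in> topspace Z" for x
  proof -
    obtain k where k: "x \<in> F k" using cov x by blast
    \<comment> \<open>The transition from stage \<open>k\<close> to \<open>Suc k\<close> is the one
      that fixes the order on \<open>F k\<close>.\<close>
    have "card {U\<in>\<U>. x \<in> H U} \<le> card {U\<in>\<U>. x \<in> C (Suc k) U}"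
      using fin by (intro card_mono) (auto simp: H_def)
    also have "int \<dots> \<le> n + 1" using f(2)[of k] k by (simp add: Q_def C_def)
    finally show ?thesis by simp
  qed
  obtain V where V: "\<And>U. U \<in> \<U> \<Longrightarrow> openin Z (V U)" "\<And>U. U \<in> \<U> \<Longrightarrow> H U \<subseteq> V U"
    "\<And>x. x \<in> topspace Z \<Longrightarrow> int (card {U \<in> \<U>. x \<in> V U}) \<le> n + 1"
    using closed_family_swell[OF pn fin Hcl Hord] by metis
  show "\<exists>(J::'a set set) W. finite J \<and> (\<forall>j\<in>J. openin Z (W j) \<and> (\<exists>U\<in>\<U>. W j \<subseteq> U)) \<and>
      topspace Z \<subseteq> (\<Union>j\<in>J. W j) \<and> (\<forall>x\<in>topspace Z. int (card {j\<in>J. x \<in> W j}) \<le> n + 1)"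
  proof (intro exI conjI ballI)
    show "openin Z (U \<inter> V U)" if "U \<in> \<U>" for U using op V(1) that by blast
    show "\<exists>U'\<in>\<U>. U \<inter> V U \<subseteq> U'" if "U \<in> \<U>" for U using that by blast
    show "topspace Z \<subseteq> (\<Union>U\<in>\<U>. U \<inter> V U)"
    proof
      fix x assume "x \<in> topspace Z"
      then obtain U where U: "U \<in> \<U>" "x \<in> H U" using Hcov by blast
      moreover have "H U \<subseteq> U" using CU[OF U(1), of 0] by (auto simp: H_def)
      ultimately show "x \<in> (\<Union>U\<in>\<U>. U \<inter> V U)" using V(2)[OF U(1)] by blast
    qed
    fix x assume x: "x \<in> topspace Z"
    have "card {U\<in>\<U>. x \<in> U \<inter> V U} \<le> card {U\<in>\<U>. x \<in> V U}"
      using fin by (intro card_mono) auto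
    then show "int (card {U\<in>\<U>. x \<in> U \<inter> V U}) \<le> n + 1" using V(3)[OF x] by linarith
  qed (rule fin)
qed

section \<open>Dimension of subsets of metric spaces\<close>

lemma metrizable_imp_perfectly_normal_space:
  "metrizable_space Z \<Longrightarrow> perfectly_normal_space Z"
  by (simp add: perfectly_normal_space_def metrizable_imp_normal_space closed_imp_gdelta_in)

lemma perfectly_normal_space_top_of_set:
  "perfectly_normal_space (top_of_set (S::'a::metric_space set))"
  by (simp add: metrizable_imp_perfectly_normal_space metrizable_space_subtopology metrizable_space_euclidean)

lemma covering_dim_le_closed_subset:
  assumes dim: "covering_dim_le Z n" and A: "closedin Z A"
  shows "covering_dim_le (subtopology Z A) n"
proof (rule covering_dim_leI)
  fix \<U> assume fin: "finite \<U>" and op: "\<And>U. U \<in> \<U> \<Longrightarrow> openin (subtopology Z A) U"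
    and cov: "topspace (subtopology Z A) \<subseteq> \<Union>\<U>"
  have AZ: "A \<subseteq> topspace Z" using A by (rule closedin_subset)
  show "\<exists>(J::'a set set) W. finite J \<and> (\<forall>j\<in>J. openin (subtopology Z A) (W j) \<and> (\<exists>U\<in>\<U>. W j \<subseteq> U)) \<and>
      topspace (subtopology Z A) \<subseteq> (\<Union>j\<in>J. W j) \<and>
      (\<forall>x\<in>topspace (subtopology Z A). int (card {j\<in>J. x \<in> W j}) \<le> n + 1)"
  proof (cases "\<U> = {}")
    \<comment> \<open>With no member to absorb the complement of \<open>A\<close>, the enlarged
      family below would not cover \<open>Z\<close>; here \<open>A\<close> itself is empty.\<close>
    case True
    then show ?thesis using cov by (intro exI[of _ "{}"]) auto
  next
    case False
    have "\<exists>G. openin Z G \<and> U = G \<inter> A" if "U \<in> \<U>" for U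
      using op[OF that] by (auto simp: openin_subtopology)
    then obtain G where G: "\<And>U. U \<in> \<U> \<Longrightarrow> openin Z (G U)" "\<And>U. U \<in> \<U> \<Longrightarrow> U = G U \<inter> A" by metis
    have op': "openin Z (G U \<union> (topspace Z - A))" if "U \<in> \<U>" for U
      using G(1)[OF that] A by blast
    have cov': "topspace Z \<subseteq> (\<Union>U\<in>\<U>. G U \<union> (topspace Z - A))"
    proof
      fix x assume x: "x \<in> topspace Z"
      show "x \<in> (\<Union>U\<in>\<U>. G U \<union> (topspace Z - A))"
      proof (cases "x \<in> A")
        case True
        then obtain U where "U \<in> \<U>" "x \<in> U" using cov x by auto
        then show ?thesis using G(2)[of U] by blast
      qed (use False x in auto)
    qed
    obtain W where W: "\<And>U. U \<in> \<U> \<Longrightarrow> openin Z (W U)"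
      "\<And>U. U \<in> \<U> \<Longrightarrow> W U \<subseteq> G U \<union> (topspace Z - A)" "topspace Z \<subseteq> (\<Union>U\<in>\<U>. W U)"
      "\<And>x. x \<in> topspace Z \<Longrightarrow> int (card {U \<in> \<U>. x \<in> W U}) \<le> n + 1"
      by (rule covering_dim_leE[OF dim fin op' cov']) (assumption, (rule that; assumption))
    show ?thesis
    proof (intro exI conjI ballI)
      show "openin (subtopology Z A) (W U \<inter> A)" if "U \<in> \<U>" for U
        using W(1)[OF that] by (rule openin_subtopology_Int)
      show "\<exists>U'\<in>\<U>. W U \<inter> A \<subseteq> U'" if "U \<in> \<U>" for U
        using W(2)[OF that] G(2)[OF that] that by blast
      show "topspace (subtopology Z A) \<subseteq> (\<Union>U\<in>\<U>. W U \<inter> A)"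
        using W(3) by auto
      fix x assume x: "x \<in> topspace (subtopology Z A)"
      then have "{U\<in>\<U>. x \<in> W U \<inter> A} = {U\<in>\<U>. x \<in> W U}" by auto
      then show "int (card {U\<in>\<U>. x \<in> W U \<inter> A}) \<le> n + 1" using W(4)[of x] x by simp
    qed (rule fin)
  qed
qed

lemma covering_dim_le_homeomorphic:
  fixes X :: "'a topology" and Y :: "'b topology"
  assumes dim: "covering_dim_le Y n" and h: "homeomorphic_maps X Y f g"
  shows "covering_dim_le X n"
proof (rule covering_dim_leI)
  have f: "continuous_map X Y f" and g: "continuous_map Y X g"
    and gf: "\<And>x. x \<in> topspace X \<Longrightarrow> g (f x) = x"
    using h by (auto simp: homeomorphic_maps_def)
  fix \<U> assume fin: "finite \<U>" and op: "\<And>U. U \<in> \<U> \<Longrightarrow> openin X U" and cov: "topspace X \<subseteq> \<Union>\<U>"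
  have fY: "f x \<in> topspace Y" if "x \<in> topspace X" for x
    using continuous_map_funspace[OF f] that by auto
  have op': "openin Y {y \<in> topspace Y. g y \<in> U}" if "U \<in> \<U>" for U
    using openin_continuous_map_preimage[OF g op[OF that]] .
  have cov': "topspace Y \<subseteq> (\<Union>U\<in>\<U>. {y \<in> topspace Y. g y \<in> U})"
    using cov continuous_map_funspace[OF g] by auto
  obtain W where W: "\<And>U. U \<in> \<U> \<Longrightarrow> openin Y (W U)"
      "\<And>U. U \<in> \<U> \<Longrightarrow> W U \<subseteq> {y \<in> topspace Y. g y \<in> U}" "topspace Y \<subseteq> (\<Union>U\<in>\<U>. W U)"
      "\<And>x. x \<in> topspace Y \<Longrightarrow> int (card {U \<in> \<U>. x \<in> W U}) \<le> n + 1"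
    by (rule covering_dim_leE[OF dim fin op' cov']) (assumption, (rule that; assumption))
  show "\<exists>(J::'a set set) W. finite J \<and> (\<forall>j\<in>J. openin X (W j) \<and> (\<exists>U\<in>\<U>. W j \<subseteq> U)) \<and>
      topspace X \<subseteq> (\<Union>j\<in>J. W j) \<and> (\<forall>x\<in>topspace X. int (card {j\<in>J. x \<in> W j}) \<le> n + 1)"
  proof (intro exI conjI ballI)
    show "openin X {x \<in> topspace X. f x \<in> W U}" if "U \<in> \<U>" for U
      using openin_continuous_map_preimage[OF f W(1)[OF that]] .
    show "\<exists>U'\<in>\<U>. {x \<in> topspace X. f x \<in> W U} \<subseteq> U'" if "U \<in> \<U>" for U
      using W(2)[OF that] gf that by (intro bexI[of _ U]) force+
    show "topspace X \<subseteq> (\<Union>U\<in>\<U>. {x \<in> topspace X. f x \<in> W U})"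
      using W(3) fY by auto
    fix x assume x: "x \<in> topspace X"
    then show "int (card {U\<in>\<U>. x \<in> {x \<in> topspace X. f x \<in> W U}}) \<le> n + 1"
      using W(4)[OF fY[OF x]] by simp
  qed (rule fin)
qed

text \<open>Each piece is a union of countably many sets closed in \<open>Q\<close>. These are also
  closed in the piece, so they inherit its bound, and \<open>prod_decode\<close> lists them all in
  one sequence for the closed sum theorem.\<close>

lemma covering_dim_le_countable_fsigma_Union:
  fixes Q :: "'a::metric_space set"
  assumes "countable \<D>" and "Q \<subseteq> \<Union>\<D>"
    and fs: "\<And>D. D \<in> \<D> \<Longrightarrow> fsigma_in (top_of_set Q) D"
    and dim: "\<And>D. D \<in> \<D> \<Longrightarrow> covering_dim_le (top_of_set D) n"
  shows "covering_dim_le (top_of_set Q) n"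
proof (cases "\<D> = {}")
  case True
  then have "Q = {}" using assms by simp
  then show ?thesis
    by (intro covering_dim_leI exI[of _ "{}::nat set"]) auto
next
  case False
  define D where "D = from_nat_into \<D>"
  have D: "range D = \<D>" unfolding D_def using False assms(1) by (rule range_from_nat_into)
  have "\<exists>C. (\<forall>m::nat. closedin (top_of_set Q) (C m)) \<and> \<Union>(range C) = D k" for k::nat
    using fs[of "D k"] D unfolding fsigma_in_ascending by blast
  then obtain C where C: "\<And>k m::nat. closedin (top_of_set Q) (C k m)" "\<And>k. \<Union>(range (C k)) = D k"
    by metis
  define F where "F i = case_prod C (prod_decode i)" for i
  show ?thesis
  proof (rule covering_dim_le_countable_closed_Union[of _ F])
    show "perfectly_normal_space (top_of_set Q)" by (rule perfectly_normal_space_top_of_set)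
    fix i
    obtain k m where km: "prod_decode i = (k, m)" by fastforce
    then have F: "F i = C k m" by (simp add: F_def)
    show "closedin (top_of_set Q) (F i)" using C F by simp
    have sub: "F i \<subseteq> D k" using C(2)[of k] F by auto
    have Dk: "D k \<in> \<D>" using D by blast
    have DQ: "D k \<subseteq> Q" using fsigma_in_subset[OF fs[OF Dk]] by auto
    then have "closedin (top_of_set (D k)) (F i)"
      using C(1)[of k m] F sub DQ by (simp add: closedin_subset_trans)
    then have "covering_dim_le (subtopology (top_of_set (D k)) (F i)) n"
      by (rule covering_dim_le_closed_subset[OF dim[OF Dk]])
    then show "covering_dim_le (subtopology (top_of_set Q) (F i)) n"
      using sub DQ by (simp add: subtopology_subtopology inf.absorb2 order_trans)
  next
    show "topspace (top_of_set Q) \<subseteq> (\<Union>k. F k)"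
    proof
      fix x assume "x \<in> topspace (top_of_set Q)"
      then obtain k where "x \<in> D k" using assms(2) D by auto
      then obtain m where "x \<in> C k m" using C(2)[of k] by auto
      then have "x \<in> F (prod_encode (k, m))" by (simp add: F_def)
      then show "x \<in> (\<Union>k. F k)" by blast
    qed
  qed
qed

text \<open>Open sets of \<open>A\<close> extend to open sets of \<open>B\<close>, but these cover
  only an open part \<open>B'\<close> of \<open>B\<close>. In a metric space \<open>B'\<close> is
  F-sigma, so the closed sum theorem bounds its dimension, and a shrinking found on
  \<open>B'\<close> restricts to \<open>A\<close>.\<close>

lemma covering_dim_le_subset:
  fixes A B :: "'a::metric_space set"
  assumes dim: "covering_dim_le (top_of_set B) n" and AB: "A \<subseteq> B"
  shows "covering_dim_le (top_of_set A) n"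
proof (rule covering_dim_leI)
  fix \<U> assume fin: "finite \<U>" and op: "\<And>U. U \<in> \<U> \<Longrightarrow> openin (top_of_set A) U"
    and cov: "topspace (top_of_set A) \<subseteq> \<Union>\<U>"
  have "\<exists>G. open G \<and> U = A \<inter> G" if "U \<in> \<U>" for U
    using op[OF that] by (auto simp: openin_open)
  then obtain G where G: "\<And>U. U \<in> \<U> \<Longrightarrow> open (G U)" "\<And>U. U \<in> \<U> \<Longrightarrow> U = A \<inter> G U" by metis
  define B' where "B' = B \<inter> (\<Union>U\<in>\<U>. G U)"
  have dim': "covering_dim_le (top_of_set B') n"
  proof -
    have "openin (top_of_set B) B'"
      unfolding B'_def using G(1) by (intro openin_open_Int) auto
    then have "gdelta_in (top_of_set B) (B - B')"
      using perfectly_normal_space_top_of_set[of B]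
      by (metis closedin_diff closedin_topspace perfectly_normal_space_def topspace_euclidean_subtopology)
    then have "fsigma_in (top_of_set B) B'"
      using fsigma_in_diff[OF fsigma_in_topspace, of "top_of_set B" "B - B'"]
      by (simp add: B'_def double_diff)
    then obtain C where C: "\<And>k::nat. closedin (top_of_set B) (C k)" "\<Union>(range C) = B'"
      unfolding fsigma_in_ascending by metis
    show ?thesis
    proof (rule covering_dim_le_countable_closed_Union[OF perfectly_normal_space_top_of_set, of _ C])
      fix k
      have sub: "C k \<subseteq> B'" "B' \<subseteq> B" using C(2) B'_def by auto
      then show "closedin (top_of_set B') (C k)" using C(1) closedin_subset_trans by blast
      show "covering_dim_le (subtopology (top_of_set B') (C k)) n"
        using covering_dim_le_closed_subset[OF dim C(1)[of k]] sub
        by (simp add: subtopology_subtopology inf.absorb2)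
    qed (use C in auto)
  qed
  have op': "openin (top_of_set B') (B' \<inter> G U)" if "U \<in> \<U>" for U
    using G(1)[OF that] by blast
  have cov': "topspace (top_of_set B') \<subseteq> (\<Union>U\<in>\<U>. B' \<inter> G U)" by (auto simp: B'_def)
  obtain W where W: "\<And>U. U \<in> \<U> \<Longrightarrow> openin (top_of_set B') (W U)"
      "\<And>U. U \<in> \<U> \<Longrightarrow> W U \<subseteq> B' \<inter> G U" "B' \<subseteq> (\<Union>U\<in>\<U>. W U)"
      "\<And>x. x \<in> B' \<Longrightarrow> int (card {U \<in> \<U>. x \<in> W U}) \<le> n + 1"
    by (rule covering_dim_leE[OF dim' fin op' cov', unfolded topspace_euclidean_subtopology]) (assumption, (rule that; assumption))
  have AB': "A \<subseteq> B'" using AB cov G(2) by (fastforce simp: B'_def)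
  show "\<exists>(J::'a set set) W. finite J \<and> (\<forall>j\<in>J. openin (top_of_set A) (W j) \<and> (\<exists>U\<in>\<U>. W j \<subseteq> U)) \<and>
      topspace (top_of_set A) \<subseteq> (\<Union>j\<in>J. W j) \<and>
      (\<forall>x\<in>topspace (top_of_set A). int (card {j\<in>J. x \<in> W j}) \<le> n + 1)"
  proof (intro exI conjI ballI)
    show "openin (top_of_set A) (A \<inter> W U)" if U: "U \<in> \<U>" for U
      using W(1)[OF U] AB' by (metis inf.absorb_iff2 inf_commute openin_subtopology_Int2 subtopology_subtopology)
    show "\<exists>U'\<in>\<U>. A \<inter> W U \<subseteq> U'" if "U \<in> \<U>" for U
      using W(2)[OF that] G(2)[OF that] that by blast
    show "topspace (top_of_set A) \<subseteq> (\<Union>U\<in>\<U>. A \<inter> W U)"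
      using W(3) AB' by auto
    fix x assume "x \<in> topspace (top_of_set A)"
    then have x: "x \<in> A" by simp
    then have "{U\<in>\<U>. x \<in> A \<inter> W U} = {U\<in>\<U>. x \<in> W U}" by auto
    then show "int (card {U\<in>\<U>. x \<in> A \<inter> W U}) \<le> n + 1" using W(4)[of x] x AB' by auto
  qed (rule fin)
qed

section \<open>Finite-valued lower semicontinuous maps\<close>

text \<open>\<open>R y\<close> meets \<open>U\<close> in exactly one point iff it meets
  \<open>U\<close> but does not meet two disjoint open subsets of \<open>U\<close>. This is a
  difference of two open sets, hence F-sigma in a metric space.\<close>

lemma fsigma_in_singleton_trace:
  fixes R :: "'a::metric_space \<Rightarrow> 'b::metric_space set"
  assumes lsc: "\<And>V. open V \<Longrightarrow> openin (top_of_set Q) {y \<in> Q. R y \<inter> V \<noteq> {}}" and U: "open U"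
  shows "fsigma_in (top_of_set Q) {y \<in> Q. \<exists>x. R y \<inter> U = {x}}"
proof -
  define \<E> where "\<E> = {(V, W). open V \<and> open W \<and> V \<inter> W = {} \<and> V \<subseteq> U \<and> W \<subseteq> U}"
  define G where "G = (\<Union>(V, W)\<in>\<E>. {y \<in> Q. R y \<inter> V \<noteq> {}} \<inter> {y \<in> Q. R y \<inter> W \<noteq> {}})"
  have "openin (top_of_set Q) G"
    unfolding G_def using lsc by (intro openin_Union) (auto simp: \<E>_def)
  then have 1: "gdelta_in (top_of_set Q) G"
    by (rule open_imp_gdelta_in)
  have "gdelta_in (top_of_set Q) (Q - {y \<in> Q. R y \<inter> U \<noteq> {}})"
    by (intro closed_imp_gdelta_in metrizable_space_subtopology metrizable_space_euclidean)
       (use lsc[OF U] in \<open>simp add: closedin_def double_diff\<close>)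
  then have 2: "fsigma_in (top_of_set Q) {y \<in> Q. R y \<inter> U \<noteq> {}}"
    by (simp add: fsigma_in_gdelta_in)
  have "{y \<in> Q. \<exists>x. R y \<inter> U = {x}} = {y \<in> Q. R y \<inter> U \<noteq> {}} - G"
  proof (intro equalityI subsetI)
    fix y assume "y \<in> {y \<in> Q. \<exists>x. R y \<inter> U = {x}}"
    then obtain x where x: "y \<in> Q" "R y \<inter> U = {x}" by blast
    have "y \<notin> G"
    proof
      assume "y \<in> G"
      then obtain V W where "V \<inter> W = {}" "V \<subseteq> U" "W \<subseteq> U" "R y \<inter> V \<noteq> {}" "R y \<inter> W \<noteq> {}"
        by (auto simp: G_def \<E>_def)
      then obtain v w where "v \<in> R y \<inter> U" "v \<in> V" "w \<in> R y \<inter> U" "w \<in> W" by blast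
      then show False using x(2) \<open>V \<inter> W = {}\<close> by auto
    qed
    then show "y \<in> {y \<in> Q. R y \<inter> U \<noteq> {}} - G" using x by auto
  next
    fix y assume y: "y \<in> {y \<in> Q. R y \<inter> U \<noteq> {}} - G"
    then obtain x where x: "x \<in> R y \<inter> U" by blast
    have "x' = x" if x': "x' \<in> R y \<inter> U" for x'
    proof (rule ccontr)
      assume "x' \<noteq> x"
      then obtain V W where VW: "open V" "open W" "x' \<in> V" "x \<in> W" "V \<inter> W = {}"
        using hausdorff by metis
      then have "(V \<inter> U, W \<inter> U) \<in> \<E>" using U by (auto simp: \<E>_def)
      then have "y \<in> G" unfolding G_def
        by (rule UN_I) (use VW x x' y in auto)
      then show False using y by blast
    qed
    then show "y \<in> {y \<in> Q. \<exists>x. R y \<inter> U = {x}}" using x y by blast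
  qed
  then show ?thesis using 1 2 by (simp add: fsigma_in_diff)
qed

text \<open>The selected point lies in \<open>V\<close> iff \<open>R y\<close> meets
  \<open>U \<inter> V\<close>, so lower semicontinuity becomes continuity of the selection.\<close>

lemma continuous_on_singleton_trace:
  fixes R :: "'a::metric_space \<Rightarrow> 'b::metric_space set"
  assumes lsc: "\<And>V. open V \<Longrightarrow> openin (top_of_set Q) {y \<in> Q. R y \<inter> V \<noteq> {}}" and U: "open U"
  shows "continuous_on {y \<in> Q. \<exists>x. R y \<inter> U = {x}} (\<lambda>y. the_elem (R y \<inter> U))"
    (is "continuous_on ?T ?t")
  unfolding continuous_openin_preimage_eq
proof (intro allI impI)
  fix V :: "'b set" assume V: "open V"
  have "?t y \<in> V \<longleftrightarrow> R y \<inter> (U \<inter> V) \<noteq> {}" if y: "y \<in> ?T" for y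
  proof -
    obtain x where x: "R y \<inter> U = {x}" using y by blast
    have "R y \<inter> (U \<inter> V) = {x} \<inter> V" unfolding x[symmetric] by blast
    then show ?thesis by (simp add: x)
  qed
  then have "?T \<inter> ?t -` V = ?T \<inter> {y \<in> Q. R y \<inter> (U \<inter> V) \<noteq> {}}" by auto
  moreover have "openin (top_of_set Q) {y \<in> Q. R y \<inter> (U \<inter> V) \<noteq> {}}"
    by (intro lsc open_Int U V)
  then obtain W where "open W" "{y \<in> Q. R y \<inter> (U \<inter> V) \<noteq> {}} = Q \<inter> W"
    unfolding openin_open by blast
  ultimately have "?T \<inter> ?t -` V = ?T \<inter> W" by auto
  then show "openin (top_of_set ?T) (?T \<inter> ?t -` V)"
    using openin_open_Int[OF \<open>open W\<close>] by simp
qed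

text \<open>Locally, \<open>R\<close> and \<open>S\<close> pick out single points, and where the two selections are inverse to
  each other they embed a piece of \<open>Q\<close> into \<open>P\<close>. By second countability, countably many pieces
  suffice.\<close>

proposition covering_dim_le_transfer_metric:
  fixes P :: "'a::{metric_space, second_countable_topology} set"
    and Q :: "'b::{metric_space, second_countable_topology} set"
  assumes R: "\<And>y. y \<in> Q \<Longrightarrow> R y \<subseteq> P" "\<And>y. y \<in> Q \<Longrightarrow> finite (R y)"
    and S: "\<And>x. x \<in> P \<Longrightarrow> S x \<subseteq> Q" "\<And>x. x \<in> P \<Longrightarrow> finite (S x)"
    and lscR: "\<And>U. open U \<Longrightarrow> openin (top_of_set Q) {y \<in> Q. R y \<inter> U \<noteq> {}}"
    and lscS: "\<And>U. open U \<Longrightarrow> openin (top_of_set P) {x \<in> P. S x \<inter> U \<noteq> {}}"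
    and mutual: "\<And>y. y \<in> Q \<Longrightarrow> \<exists>x\<in>R y. y \<in> S x"
    and dim: "covering_dim_le (top_of_set P) n"
  shows "covering_dim_le (top_of_set Q) n"
proof -
  define T where "T U = {y \<in> Q. \<exists>x. R y \<inter> U = {x}}" for U
  define t where "t U y = the_elem (R y \<inter> U)" for U y
  define T' where "T' V = {x \<in> P. \<exists>y. S x \<inter> V = {y}}" for V
  define s where "s V x = the_elem (S x \<inter> V)" for V x
  \<comment> \<open>On \<open>L U V\<close> both selections can be composed. \<open>D U V\<close> is
    the fixed point set of the composite, so \<open>s V\<close> inverts \<open>t U\<close>
    there.\<close>
  define L where "L U V = {y \<in> T U. t U y \<in> T' V}" for U V
  define D where "D U V = {y \<in> L U V. s V (t U y) = y}" for U V
  obtain \<B> :: "'a set set" where \<B>: "countable \<B>" "topological_basis \<B>"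
    using ex_countable_basis by blast
  obtain \<B>' :: "'b set set" where \<B>': "countable \<B>'" "topological_basis \<B>'"
    using ex_countable_basis by blast
  have isolate: "\<exists>U\<in>\<C>. F \<inter> U = {x}" if \<C>: "topological_basis \<C>" and F: "finite F" "x \<in> F"
    for \<C> :: "'c::metric_space set set" and F x
  proof -
    have "open (- (F - {x}))" using F(1) by (intro open_Compl finite_imp_closed) simp
    moreover have "x \<in> - (F - {x})" by simp
    ultimately obtain U where "U \<in> \<C>" "x \<in> U" "U \<subseteq> - (F - {x})"
      by (rule topological_basisE[OF \<C>])
    then show ?thesis using F(2) by (intro bexI[of _ U]) auto
  qed
  have contt: "continuous_on (T U) (t U)" if "open U" for U
    unfolding T_def t_def using lscR that by (rule continuous_on_singleton_trace)
  have conts: "continuous_on (T' V) (s V)" if "open V" for V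
    unfolding T'_def s_def using lscS that by (rule continuous_on_singleton_trace)
  \<comment> \<open>A continuous preimage of an F-sigma set is F-sigma in \<open>T U\<close>, which
    is itself F-sigma in \<open>Q\<close>.\<close>
  have fsL: "fsigma_in (top_of_set Q) (L U V)" if U: "open U" and V: "open V" for U V
  proof -
    have fsT: "fsigma_in (top_of_set Q) (T U)"
      unfolding T_def using lscR U by (rule fsigma_in_singleton_trace)
    have "fsigma_in (top_of_set P) (T' V)"
      unfolding T'_def using lscS V by (rule fsigma_in_singleton_trace)
    then obtain C where C: "\<And>k::nat. closedin (top_of_set P) (C k)" "\<Union>(range C) = T' V"
      unfolding fsigma_in_ascending by metis
    have tP: "t U \<in> T U \<rightarrow> P"
      using R by (fastforce simp: T_def t_def)
    have "closedin (top_of_set (T U)) (T U \<inter> t U -` C k)" for k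
      by (rule continuous_closedin_preimage_gen[OF contt[OF U] tP C(1)])
    then have "fsigma_in (top_of_set (T U)) (\<Union>k. T U \<inter> t U -` C k)"
      by (intro fsigma_in_Union) (auto intro: closed_imp_fsigma_in)
    moreover have "(\<Union>k. T U \<inter> t U -` C k) = L U V"
      unfolding L_def C(2)[symmetric] by auto
    moreover have "T U \<subseteq> Q" by (auto simp: T_def)
    ultimately have "fsigma_in (subtopology (top_of_set Q) (T U)) (L U V)"
      by (simp add: subtopology_subtopology inf.absorb2)
    then show ?thesis using fsT fsigma_in_fsigma_subtopology by blast
  qed
  have contL: "continuous_on (L U V) (t U)" "continuous_on (L U V) (\<lambda>y. s V (t U y))"
    if U: "open U" and V: "open V" for U V
  proof -
    show *: "continuous_on (L U V) (t U)"
      by (rule continuous_on_subset[OF contt[OF U]]) (auto simp: L_def)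
    show "continuous_on (L U V) (\<lambda>y. s V (t U y))"
      by (rule continuous_on_compose2[OF conts[OF V] *]) (auto simp: L_def)
  qed
  have fsD: "fsigma_in (top_of_set Q) (D U V)" if U: "open U" and V: "open V" for U V
  proof -
    \<comment> \<open>Two continuous maps into a Hausdorff space, here the composite and the
      identity, agree on a closed set.\<close>
    have "closedin (top_of_set (L U V)) (D U V)"
      using closedin_continuous_maps_eq[OF Hausdorff_space_euclidean, of "top_of_set (L U V)" "\<lambda>y. s V (t U y)" "\<lambda>y. y"]
        contL[OF that] by (simp add: D_def)
    moreover have "L U V \<subseteq> Q" by (auto simp: L_def T_def)
    ultimately have "fsigma_in (subtopology (top_of_set Q) (L U V)) (D U V)"
      by (simp add: subtopology_subtopology inf.absorb2 closed_imp_fsigma_in)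
    then show ?thesis using fsL[OF that] fsigma_in_fsigma_subtopology by blast
  qed
  have dimD: "covering_dim_le (top_of_set (D U V)) n" if U: "open U" and V: "open V" for U V
  proof (rule covering_dim_le_homeomorphic)
    \<comment> \<open>The image may be an arbitrary subset of \<open>P\<close>, hence the appeal to
      the subspace theorem.\<close>
    have "t U ` D U V \<subseteq> P" by (auto simp: D_def L_def T'_def)
    then show "covering_dim_le (top_of_set (t U ` D U V)) n"
      by (rule covering_dim_le_subset[OF dim])
    have "continuous_on (D U V) (t U)"
      by (rule continuous_on_subset[OF contL(1)[OF that]]) (auto simp: D_def)
    moreover have "continuous_on (t U ` D U V) (s V)"
      by (rule continuous_on_subset[OF conts[OF V]]) (auto simp: D_def L_def)
    ultimately show "homeomorphic_maps (top_of_set (D U V)) (top_of_set (t U ` D U V)) (t U) (s V)"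
      unfolding homeomorphic_maps_def by (auto simp: D_def)
  qed
  show ?thesis
  proof (rule covering_dim_le_countable_fsigma_Union)
    let ?\<D> = "(\<lambda>(U, V). D U V) ` (\<B> \<times> \<B>')"
    show "countable ?\<D>" using \<B> \<B>' by simp
    have op: "open U" "open V" if "U \<in> \<B>" "V \<in> \<B>'" for U V
      using \<B> \<B>' that topological_basis_open by blast+
    show "fsigma_in (top_of_set Q) E" "covering_dim_le (top_of_set E) n" if "E \<in> ?\<D>" for E
      using that fsD dimD op by auto
    show "Q \<subseteq> \<Union>?\<D>"
    proof
      fix y assume y: "y \<in> Q"
      \<comment> \<open>\<open>mutual\<close> supplies a point at which the selections can be made
        inverse: finiteness lets \<open>U\<close> isolate \<open>x\<close> in \<open>R y\<close> and
        \<open>V\<close> isolate \<open>y\<close> in \<open>S x\<close>.\<close>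
      obtain x where x: "x \<in> R y" "y \<in> S x" using mutual[OF y] by blast
      have xP: "x \<in> P" using R(1)[OF y] x by blast
      obtain U where U: "U \<in> \<B>" "R y \<inter> U = {x}" using isolate[OF \<B>(2) R(2)[OF y] x(1)] by blast
      obtain V where V: "V \<in> \<B>'" "S x \<inter> V = {y}" using isolate[OF \<B>'(2) S(2)[OF xP] x(2)] by blast
      have "t U y = x" "s V x = y" using U V by (simp_all add: t_def s_def)
      then have "y \<in> D U V" using U V y xP by (simp add: D_def L_def T_def T'_def)
      then show "y \<in> \<Union>?\<D>" using U V by blast
    qed
  qed
qed

section \<open>Factorization through subsets of the Hilbert cube\<close>

lemma dist_fun_less_finitely_many_coordinates:
  assumes "0 < \<delta>"
  obtains J :: "nat set" and e :: real where "finite J" "0 < e"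
    "\<And>x y :: nat \<Rightarrow> real. (\<And>j. j \<in> J \<Longrightarrow> \<bar>x j - y j\<bar> \<le> e) \<Longrightarrow> dist x y < \<delta>"
proof -
  \<comment> \<open>The distance is at most twice the largest difference among the first coordinates
    plus the tail \<open>(1/2)^M\<close>. Tolerance \<delta>/4 and a tail below \<delta>/2 give less
    than \<delta>; the metric enumerates coordinates by \<open>from_nat\<close>.\<close>
  obtain M where M: "(1/2::real)^M < \<delta>/2"
    using real_arch_pow_inv[of "\<delta>/2" "1/2"] assms by auto
  show thesis
  proof
    show "finite (from_nat ` {..M} :: nat set)" by simp
    show "0 < \<delta>/4" using assms by simp
    fix x y :: "nat \<Rightarrow> real" assume xy: "\<And>j. j \<in> from_nat ` {..M} \<Longrightarrow> \<bar>x j - y j\<bar> \<le> \<delta>/4"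
    have eq: "{dist (x (from_nat n)) (y (from_nat n)) |n. n \<le> M} = (\<lambda>n. dist (x (from_nat n)) (y (from_nat n))) ` {..M}"
      by auto
    have "dist x y \<le> 2 * Max {dist (x (from_nat n)) (y (from_nat n)) |n. n \<le> M} + (1/2)^M"
      by (rule dist_fun_le_dist_first_terms)
    also have "Max {dist (x (from_nat n)) (y (from_nat n)) |n. n \<le> M} \<le> \<delta>/4"
      unfolding eq using xy by (intro Max.boundedI) (auto simp: dist_real_def)
    finally show "dist x y < \<delta>" using M by linarith
  qed
qed

lemma compact_Hilbert_cube: "compact {y :: nat \<Rightarrow> real. \<forall>j. y j \<in> {0..1}}"
proof -
  have "compactin (product_topology (\<lambda>i::nat. euclidean::real topology) UNIV) (PiE UNIV (\<lambda>_. {0..1}))"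
    by (simp add: compactin_PiE)
  moreover have "PiE UNIV (\<lambda>_. {0..1}) = {y :: nat \<Rightarrow> real. \<forall>j. y j \<in> {0..1}}" by auto
  ultimately show ?thesis by (simp add: euclidean_product_topology)
qed

text \<open>The hypothesis lets every cover of the compact closure \<open>K\<close> of \<open>Y\<close> be refined by the sets
  \<open>{z. z j > 1/2}\<close>; their order and their diameters are controlled on \<open>Y\<close>, hence on \<open>K\<close>.\<close>

lemma covering_dim_le_Hilbert_cube_subset:
  fixes Y :: "(nat \<Rightarrow> real) set"
  assumes Y01: "\<And>y j. y \<in> Y \<Longrightarrow> y j \<in> {0..1}"
    and fine: "\<And>J e. finite J \<Longrightarrow> 0 < e \<Longrightarrow> \<exists>B. finite B \<and> (\<forall>y\<in>Y. \<exists>j\<in>B. y j = 1) \<and>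
      (\<forall>y\<in>Y. int (card {j\<in>B. 0 < y j}) \<le> n + 1) \<and>
      (\<forall>j\<in>B. \<forall>y\<in>Y. \<forall>y'\<in>Y. 0 < y j \<longrightarrow> 0 < y' j \<longrightarrow> (\<forall>i\<in>J. \<bar>y i - y' i\<bar> \<le> e))"
  shows "covering_dim_le (top_of_set Y) n"
proof -
  define K where "K = closure Y"
  have "closed {y :: nat \<Rightarrow> real. \<forall>j. y j \<in> {0..1}}"
    using compact_Hilbert_cube by (rule compact_imp_closed)
  then have "K \<subseteq> {y. \<forall>j. y j \<in> {0..1}}"
    unfolding K_def by (rule closure_minimal[rotated]) (use Y01 in blast)
  then have cK: "compact K"
    using closed_Int_compact[of K, OF _ compact_Hilbert_cube] by (simp add: K_def inf.absorb1)
  have cont: "continuous_on UNIV (\<lambda>z::nat\<Rightarrow>real. z j)" for j by simp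
  \<comment> \<open>The threshold lies strictly between 0 and 1: on \<open>Y\<close>, points of
    \<open>H j\<close> have positive coordinate \<open>j\<close>, while \<open>y j = 1\<close>
    persists in the closure as \<open>1 \<le> z j\<close> and puts \<open>z\<close> in
    \<open>H j\<close>.\<close>
  define H :: "nat \<Rightarrow> (nat \<Rightarrow> real) set" where "H j = {z. 1/2 < z j}" for j
  have opH: "open (H j)" for j
    unfolding H_def by (intro open_Collect_less continuous_on_const cont)
  have dense: "H j \<inter> K \<subseteq> closure (H j \<inter> Y)" for j
    unfolding K_def by (rule open_Int_closure_subset[OF opH])
  have "covering_dim_le (top_of_set K) n"
  proof (rule covering_dim_leI)
    fix \<U> assume "finite \<U>" and opU: "\<And>U. U \<in> \<U> \<Longrightarrow> openin (top_of_set K) U"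
      and cov: "topspace (top_of_set K) \<subseteq> \<Union>\<U>"
    have "\<forall>U\<in>\<U>. \<exists>G. open G \<and> U = K \<inter> G"
      using opU by (auto simp: openin_open)
    from bchoice[OF this] obtain G where G: "\<forall>U\<in>\<U>. open (G U) \<and> U = K \<inter> G U" by blast
    have KG: "K \<subseteq> \<Union>(G ` \<U>)"
    proof
      fix z assume "z \<in> K"
      then obtain U where "U \<in> \<U>" "z \<in> U" using cov by auto
      then show "z \<in> \<Union>(G ` \<U>)" using G by blast
    qed
    \<comment> \<open>A Lebesgue number, the reason for replacing \<open>Y\<close> by its compact
      closure: a finite open cover of \<open>Y\<close> alone may have none.\<close>
    obtain \<delta> where \<delta>: "0 < \<delta>" "\<And>z. z \<in> K \<Longrightarrow> \<exists>W\<in>G ` \<U>. ball z \<delta> \<subseteq> W"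
      by (rule Heine_Borel_lemma[OF cK KG]) (use G in auto)
    obtain J e where J: "finite J" "0 < (e::real)"
      "\<And>x y :: nat \<Rightarrow> real. (\<And>j. j \<in> J \<Longrightarrow> \<bar>x j - y j\<bar> \<le> e) \<Longrightarrow> dist x y < \<delta>"
      using dist_fun_less_finitely_many_coordinates[OF \<delta>(1)] by blast
    obtain B where B: "finite B" "\<forall>y\<in>Y. \<exists>j\<in>B. y j = 1"
      "\<forall>y\<in>Y. int (card {j\<in>B. 0 < y j}) \<le> n + 1"
      "\<forall>j\<in>B. \<forall>y\<in>Y. \<forall>y'\<in>Y. 0 < y j \<longrightarrow> 0 < y' j \<longrightarrow> (\<forall>i\<in>J. \<bar>y i - y' i\<bar> \<le> e)"
      using fine[OF J(1,2)] by (elim exE conjE)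
    \<comment> \<open>The bound by \<open>e\<close> is a closed condition on pairs, so it extends
      from \<open>H j \<inter> Y\<close> to its closure, which contains
      \<open>H j \<inter> K\<close>.\<close>
    have small: "dist z z' < \<delta>" if j: "j \<in> B" and z: "z \<in> H j \<inter> K" "z' \<in> H j \<inter> K" for j z z'
    proof (rule J(3))
      fix i assume i: "i \<in> J"
      have pos: "0 < y j" if "y \<in> H j" for y
        using that unfolding H_def by (auto intro: less_trans[of 0 "1/2"])
      have "(H j \<inter> Y) \<times> (H j \<inter> Y) \<subseteq> {p. \<bar>fst p i - snd p i\<bar> \<le> e}"
        using B(4) j i pos by auto
      moreover have "closed {p :: (nat \<Rightarrow> real) \<times> (nat \<Rightarrow> real). \<bar>fst p i - snd p i\<bar> \<le> e}"
        by (intro closed_Collect_le continuous_on_rabs continuous_on_diff continuous_on_const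
            continuous_on_compose2[OF cont continuous_on_fst[OF continuous_on_id]]
            continuous_on_compose2[OF cont continuous_on_snd[OF continuous_on_id]]) auto
      ultimately have "closure ((H j \<inter> Y) \<times> (H j \<inter> Y)) \<subseteq> {p. \<bar>fst p i - snd p i\<bar> \<le> e}"
        by (rule closure_minimal)
      moreover have "(z, z') \<in> closure ((H j \<inter> Y) \<times> (H j \<inter> Y))"
        using subsetD[OF dense z(1)] subsetD[OF dense z(2)] by (simp add: closure_Times)
      ultimately show "\<bar>z i - z' i\<bar> \<le> e" by auto
    qed
    show "\<exists>(I::nat set) W. finite I \<and> (\<forall>j\<in>I. openin (top_of_set K) (W j) \<and> (\<exists>U\<in>\<U>. W j \<subseteq> U)) \<and>
      topspace (top_of_set K) \<subseteq> (\<Union>j\<in>I. W j) \<and>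
      (\<forall>x\<in>topspace (top_of_set K). int (card {j\<in>I. x \<in> W j}) \<le> n + 1)"
    proof (intro exI conjI ballI)
      \<comment> \<open>Empty sets are dropped because the member of the cover containing
        \<open>K \<inter> H j\<close> is found from a point of it.\<close>
      show "finite {j\<in>B. H j \<inter> K \<noteq> {}}" using B(1) by simp
      fix j assume "j \<in> {j\<in>B. H j \<inter> K \<noteq> {}}"
      then obtain z where j: "j \<in> B" and z: "z \<in> H j \<inter> K" by blast
      show "openin (top_of_set K) (K \<inter> H j)" using openin_open_Int[OF opH] .
      obtain U where U: "U \<in> \<U>" "ball z \<delta> \<subseteq> G U" using \<delta>(2)[of z] z by blast
      have "K \<inter> H j \<subseteq> ball z \<delta>" using small[OF j z] by auto
      then have "K \<inter> H j \<subseteq> K \<inter> G U" using U(2) by blast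
      then show "\<exists>U\<in>\<U>. K \<inter> H j \<subseteq> U" using G U(1) by metis
    next
      have "Y \<subseteq> (\<Union>j\<in>B. {z. 1 \<le> z j})" using B(2) by fastforce
      moreover have "closed (\<Union>j\<in>B. {z::nat\<Rightarrow>real. 1 \<le> z j})"
        by (intro closed_UN B(1) ballI closed_Collect_le continuous_on_const cont)
      ultimately have KB: "K \<subseteq> (\<Union>j\<in>B. {z. 1 \<le> z j})" unfolding K_def by (rule closure_minimal)
      show "topspace (top_of_set K) \<subseteq> (\<Union>j\<in>{j\<in>B. H j \<inter> K \<noteq> {}}. K \<inter> H j)"
      proof
        fix z assume "z \<in> topspace (top_of_set K)"
        then have z: "z \<in> K" by simp
        then obtain j where j: "j \<in> B" "1 \<le> z j" using KB by blast
        then have "z \<in> H j" by (simp add: H_def)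
        then show "z \<in> (\<Union>j\<in>{j\<in>B. H j \<inter> K \<noteq> {}}. K \<inter> H j)" using z j(1) by blast
      qed
    next
      fix z assume "z \<in> topspace (top_of_set K)"
      then have z: "z \<in> closure Y" by (simp add: K_def)
      \<comment> \<open>The sets \<open>H j\<close> containing \<open>z\<close> are finitely many
        and open, so one point of \<open>Y\<close> lies in all of them and carries the order bound
        over to \<open>z\<close>.\<close>
      define E where "E = {j\<in>B. z \<in> H j}"
      have "open (\<Inter>j\<in>E. H j)" using B(1) opH by (intro open_INT) (auto simp: E_def)
      moreover have "z \<in> (\<Inter>j\<in>E. H j)" by (auto simp: E_def)
      ultimately obtain y where y: "y \<in> Y" "y \<in> (\<Inter>j\<in>E. H j)"
        using z unfolding closure_iff_nhds_not_empty by (metis disjoint_iff order_refl)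
      have "card {j\<in>{j\<in>B. H j \<inter> K \<noteq> {}}. z \<in> K \<inter> H j} \<le> card {j\<in>B. 0 < y j}"
        using B(1) y(2) by (intro card_mono) (force simp: E_def H_def)+
      then show "int (card {j\<in>{j\<in>B. H j \<inter> K \<noteq> {}}. z \<in> K \<inter> H j}) \<le> n + 1"
        using bspec[OF B(3) y(1)] by linarith
    qed
  qed
  then show ?thesis
    by (rule covering_dim_le_subset) (simp add: K_def closure_subset)
qed

text \<open>Rational boxes: for countably many functions there are only countably many of them.\<close>

definition fbox :: "('a \<Rightarrow> real) set \<Rightarrow> (('a \<Rightarrow> real) \<Rightarrow> real) \<Rightarrow> nat \<Rightarrow> 'a set" where
  "fbox A q N = {x. \<forall>a\<in>A. \<bar>a x - q a\<bar> < 1 / real (Suc N)}"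

lemma openin_fbox:
  assumes "finite A" "\<And>a. a \<in> A \<Longrightarrow> continuous_map Z euclideanreal a"
  shows "openin Z (topspace Z \<inter> fbox A q N)"
proof -
  have "openin Z {x \<in> topspace Z. \<bar>a x - q a\<bar> \<in> {..<1 / real (Suc N)}}" if "a \<in> A" for a
    using that assms(2) by (intro openin_continuous_map_preimage[of Z euclideanreal] continuous_intros) auto
  then have "openin Z (\<Inter>(insert (topspace Z)
      ((\<lambda>a. {x \<in> topspace Z. \<bar>a x - q a\<bar> \<in> {..<1 / real (Suc N)}}) ` A)))"
    using assms(1) by (intro openin_Inter) auto
  moreover have "\<Inter>(insert (topspace Z)
      ((\<lambda>a. {x \<in> topspace Z. \<bar>a x - q a\<bar> \<in> {..<1 / real (Suc N)}}) ` A))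
      = topspace Z \<inter> fbox A q N"
    by (auto simp: fbox_def)
  ultimately show ?thesis by simp
qed

lemma fbox_neighbourhood:
  fixes g :: "nat \<Rightarrow> 'a \<Rightarrow> real"
  assumes U: "open U" and x: "(\<lambda>j. g j x) \<in> U"
  obtains J q N where "finite J" "q \<in> PiE (g ` J) (\<lambda>_. \<rat>)" "x \<in> fbox (g ` J) q N"
    "\<And>x'. x' \<in> fbox (g ` J) q N \<Longrightarrow> (\<lambda>j. g j x') \<in> U"
proof -
  obtain \<delta> where \<delta>: "0 < \<delta>" "ball (\<lambda>j. g j x) \<delta> \<subseteq> U"
    using U x open_contains_ball by blast
  obtain J e where J: "finite J" "0 < (e::real)"
    "\<And>x y :: nat \<Rightarrow> real. (\<And>j. j \<in> J \<Longrightarrow> \<bar>x j - y j\<bar> \<le> e) \<Longrightarrow> dist x y < \<delta>"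
    using dist_fun_less_finitely_many_coordinates[OF \<delta>(1)] by blast
  \<comment> \<open>Two points of one box differ by less than twice its radius in each coordinate
    used, hence \<open>e/2\<close>.\<close>
  obtain N where N: "1 / real (Suc N) < e/2"
    using nat_approx_posE[of "e/2"] J(2) by auto
  have "\<forall>a. \<exists>r. r \<in> \<rat> \<and> a x - 1 / real (Suc N) < r \<and> r < a x + 1 / real (Suc N)"
  proof
    fix a :: "'a \<Rightarrow> real"
    have "a x - 1 / real (Suc N) < a x + 1 / real (Suc N)" by simp
    from Rats_dense_in_real[OF this]
    show "\<exists>r. r \<in> \<rat> \<and> a x - 1 / real (Suc N) < r \<and> r < a x + 1 / real (Suc N)" by blast
  qed
  from choice[OF this] obtain r where r: "\<And>a. r a \<in> \<rat>" "\<And>a. a x - 1 / real (Suc N) < r a" "\<And>a. r a < a x + 1 / real (Suc N)"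
    by blast
  \<comment> \<open>Restriction makes the centre extensional, so that it ranges over a countable
    set.\<close>
  define q where "q = restrict r (g ` J)"
  have xb: "\<bar>a x - r a\<bar> < 1 / real (Suc N)" for a using r(2,3)[of a] by linarith
  show thesis
  proof (rule that[of J q N])
    show "q \<in> PiE (g ` J) (\<lambda>_. \<rat>)" using r(1) by (auto simp: q_def)
    show "x \<in> fbox (g ` J) q N" using xb by (auto simp: fbox_def q_def)
    fix x' assume x': "x' \<in> fbox (g ` J) q N"
    have "\<bar>g j x - g j x'\<bar> \<le> e" if j: "j \<in> J" for j
    proof -
      have "\<bar>g j x' - r (g j)\<bar> < 1 / real (Suc N)" using x' j by (simp add: fbox_def q_def)
      then show ?thesis using xb[of "g j"] N by linarith
    qed
    then have "dist (\<lambda>j. g j x) (\<lambda>j. g j x') < \<delta>" by (rule J(3))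
    then show "(\<lambda>j. g j x') \<in> U" using \<delta>(2) by auto
  qed (rule J(1))
qed

lemma lsc_map_image:
  fixes g :: "nat \<Rightarrow> 'a \<Rightarrow> real" and h :: "nat \<Rightarrow> 'b \<Rightarrow> real"
  assumes \<Phi>_def: "\<Phi> = (\<lambda>x j. g j x)" and \<Psi>_def: "\<Psi> = (\<lambda>y j. h j y)"
    and fin: "\<And>y. y \<in> Y \<Longrightarrow> finite (\<Phi> ` R y)"
    and key: "\<And>J q N. finite J \<Longrightarrow> q \<in> PiE (g ` J) (\<lambda>_. \<rat>) \<Longrightarrow>
      \<exists>j. \<forall>y\<in>Y. 0 < h j y \<longleftrightarrow> R y \<inter> fbox (g ` J) q N \<noteq> {}"
  obtains R' where "\<And>y. y \<in> Y \<Longrightarrow> R' (\<Psi> y) = \<Phi> ` R y"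
    "\<And>U. open U \<Longrightarrow> openin (top_of_set (\<Psi> ` Y)) {z \<in> \<Psi> ` Y. R' z \<inter> U \<noteq> {}}"
proof -
  define V where "V U = (\<Union>j\<in>{j. \<forall>y\<in>Y. 0 < h j y \<longrightarrow> \<Phi> ` R y \<inter> U \<noteq> {}}. {z::nat\<Rightarrow>real. 0 < z j})" for U
  have opV: "open (V U)" for U
    unfolding V_def by (intro open_UN ballI open_Collect_less continuous_on_const) simp
  have V: "\<Psi> y \<in> V U \<longleftrightarrow> \<Phi> ` R y \<inter> U \<noteq> {}" if y: "y \<in> Y" and U: "open U" for y U
  proof
    assume "\<Psi> y \<in> V U"
    then show "\<Phi> ` R y \<inter> U \<noteq> {}" using y by (auto simp: V_def \<Psi>_def)
  next
    assume "\<Phi> ` R y \<inter> U \<noteq> {}"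
    then obtain x where x: "x \<in> R y" "\<Phi> x \<in> U" by blast
    obtain J q N where J: "finite J" "q \<in> PiE (g ` J) (\<lambda>_. \<rat>)" "x \<in> fbox (g ` J) q N"
      "\<And>x'. x' \<in> fbox (g ` J) q N \<Longrightarrow> \<Phi> x' \<in> U"
      using fbox_neighbourhood[OF U, of g x] x(2) unfolding \<Phi>_def by metis
    obtain j where j': "\<forall>y\<in>Y. 0 < h j y \<longleftrightarrow> R y \<inter> fbox (g ` J) q N \<noteq> {}"
      using key[OF J(1,2), of N] by (elim exE)
    note j = bspec[OF j']
    have "\<Phi> ` R y' \<inter> U \<noteq> {}" if "y' \<in> Y" "0 < h j y'" for y'
      using j[OF that(1)] that(2) J(4) by blast
    moreover have "0 < h j y" using j[OF y] x(1) J(3) by blast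
    ultimately show "\<Psi> y \<in> V U" by (auto simp: V_def \<Psi>_def)
  qed
  have sub: "\<Phi> ` R y \<subseteq> \<Phi> ` R y'" if y: "y \<in> Y" "y' \<in> Y" "\<Psi> y = \<Psi> y'" for y y'
  proof (rule ccontr)
    assume "\<not> ?thesis"
    then have "\<Phi> ` R y \<inter> (- \<Phi> ` R y') \<noteq> {}" by blast
    moreover have "open (- \<Phi> ` R y')"
      using fin[OF y(2)] by (intro open_Compl finite_imp_closed)
    ultimately have "\<Phi> ` R y' \<inter> (- \<Phi> ` R y') \<noteq> {}" using V y by metis
    then show False by blast
  qed
  define R' where "R' z = (\<Union>y\<in>{y\<in>Y. \<Psi> y = z}. \<Phi> ` R y)" for z
  have R': "R' (\<Psi> y) = \<Phi> ` R y" if "y \<in> Y" for y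
    unfolding R'_def using sub that by blast
  have "R' z \<inter> U \<noteq> {} \<longleftrightarrow> z \<in> V U" if "open U" "z \<in> \<Psi> ` Y" for U z
    using that R' V by (metis imageE)
  then have "{z \<in> \<Psi> ` Y. R' z \<inter> U \<noteq> {}} = \<Psi> ` Y \<inter> V U" if "open U" for U
    using that by blast
  then have R'op: "openin (top_of_set (\<Psi> ` Y)) {z \<in> \<Psi> ` Y. R' z \<inter> U \<noteq> {}}" if "open U" for U
    using openin_open_Int[OF opV[of U], of "\<Psi> ` Y"] that by simp
  show thesis
    by (rule that[of R', OF R' R'op])
qed

section \<open>Closing off countable families of functions\<close>

text \<open>A Loewenheim-Skolem style closure: \<open>op\<close> takes only finite arguments, so
  each argument drawn from the union already lies in one stage and is served at the next.\<close>

lemma countable_closed_off: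
  fixes op :: "'x set \<Rightarrow> 'x set"
  assumes "countable C0" "C0 \<subseteq> W"
    and op: "\<And>A. finite A \<Longrightarrow> A \<subseteq> W \<Longrightarrow> countable (op A)" "\<And>A. finite A \<Longrightarrow> A \<subseteq> W \<Longrightarrow> op A \<subseteq> W"
  obtains C where "countable C" "C0 \<subseteq> C" "C \<subseteq> W" "\<And>A. finite A \<Longrightarrow> A \<subseteq> C \<Longrightarrow> op A \<subseteq> C"
proof -
  define F where "F = rec_nat C0 (\<lambda>_ E. E \<union> \<Union>(op ` {A. finite A \<and> A \<subseteq> E}))"
  have F0: "F 0 = C0" and FS: "F (Suc n) = F n \<union> \<Union>(op ` {A. finite A \<and> A \<subseteq> F n})" for n
    by (simp_all add: F_def)
  have FW: "countable (F n) \<and> F n \<subseteq> W" for n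
  proof (induction n)
    case 0
    then show ?case using assms by (simp add: F0)
  next
    case (Suc n)
    have "countable {A. finite A \<and> A \<subseteq> F n}" using Suc by (intro countable_Collect_finite_subset) simp
    moreover have "countable (op A)" "op A \<subseteq> W" if "A \<in> {A. finite A \<and> A \<subseteq> F n}" for A
      using op that Suc by auto
    ultimately show ?case using Suc unfolding FS by (auto intro!: countable_UN)
  qed
  have mono: "F m \<subseteq> F n" if "m \<le> n" for m n
    by (rule lift_Suc_mono_le[OF _ that]) (auto simp: FS)
  have cover: "\<exists>n. A \<subseteq> F n" if "finite A" "A \<subseteq> (\<Union>n. F n)" for A
    using that
  proof (induction A)
    case (insert a A)
    then obtain m n where "A \<subseteq> F n" "a \<in> F m" by auto
    then have "insert a A \<subseteq> F (max m n)" using mono[of m "max m n"] mono[of n "max m n"] by auto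
    then show ?case by blast
  qed simp
  show thesis
  proof (rule that[of "\<Union>n. F n"])
    show "countable (\<Union>n. F n)" using FW by auto
    show "C0 \<subseteq> (\<Union>n. F n)" using F0 by blast
    show "(\<Union>n. F n) \<subseteq> W" using FW by blast
    fix A assume A: "finite A" "A \<subseteq> (\<Union>n. F n)"
    then obtain n where "A \<subseteq> F n" using cover by blast
    then have "op A \<subseteq> F (Suc n)" using A(1) by (auto simp: FS)
    then show "op A \<subseteq> (\<Union>n. F n)" by blast
  qed
qed

definition unit_maps :: "'a topology \<Rightarrow> ('a \<Rightarrow> real) set" where
  "unit_maps Z = {f. continuous_map Z euclideanreal f \<and> (\<forall>x\<in>topspace Z. f x \<in> {0..1})}"

text \<open>Boxes centred at grid values of the functions in \<open>A\<close> form a finite cover.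
  Functions subordinate to a shrinking of the right order inherit its order and are supported in
  boxes, hence the factor 2.\<close>

lemma covering_dim_le_small_oscillation:
  assumes pn: "perfectly_normal_space Z" and dim: "covering_dim_le Z n" and A: "finite A" "A \<subseteq> unit_maps Z"
  shows "\<exists>B. finite B \<and> B \<subseteq> unit_maps Z \<and>
    (\<forall>x\<in>topspace Z. \<exists>b\<in>B. b x = 1) \<and>
    (\<forall>x\<in>topspace Z. int (card {b\<in>B. 0 < b x}) \<le> n + 1) \<and>
    (\<forall>b\<in>B. \<forall>x\<in>topspace Z. \<forall>y\<in>topspace Z. 0 < b x \<longrightarrow> 0 < b y \<longrightarrow> (\<forall>a\<in>A. \<bar>a x - a y\<bar> \<le> 2 / real (Suc N)))"
proof -
  have a: "continuous_map Z euclideanreal a" "x \<in> topspace Z \<Longrightarrow> a x \<in> {0..1}" if "a \<in> A" for a x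
    using A(2) that by (auto simp: unit_maps_def)
  define I where "I = PiE A (\<lambda>_. {..Suc N})"
  have finI: "finite I" unfolding I_def using A(1) by (intro finite_PiE) auto
  define U where "U k = topspace Z \<inter> fbox A (\<lambda>a. real (k a) / real (Suc N)) N" for k
  have opU: "openin Z (U k)" for k
    unfolding U_def using A(1) a(1) by (rule openin_fbox)
  have covU: "topspace Z \<subseteq> (\<Union>k\<in>I. U k)"
  proof
    fix x assume x: "x \<in> topspace Z"
    \<comment> \<open>The floor is \<open>Suc N\<close> when \<open>a x = 1\<close>, so the grid has
      to include that endpoint.\<close>
    define k where "k = restrict (\<lambda>a. nat \<lfloor>real (Suc N) * a x\<rfloor>) A"
    have "k a \<le> Suc N" "\<bar>a x - real (k a) / real (Suc N)\<bar> < 1 / real (Suc N)" if "a \<in> A" for a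
    proof -
      have a01: "0 \<le> a x" "a x \<le> 1" using a(2)[OF that x] by auto
      then have "0 \<le> real (Suc N) * a x" by simp
      then have k: "real (k a) \<le> real (Suc N) * a x" "real (Suc N) * a x < real (k a) + 1"
        using that by (simp_all add: k_def)
      have "real (Suc N) * a x \<le> real (Suc N) * 1" using a01(2) by (intro mult_left_mono) auto
      from order_trans[OF k(1) this] have "real (k a) \<le> real (Suc N)" by (simp only: mult_1_right)
      then show "k a \<le> Suc N" by (simp only: of_nat_le_iff)
      have "a x - real (k a) / real (Suc N) = (real (Suc N) * a x - real (k a)) / real (Suc N)"
        by (simp add: diff_divide_distrib)
      moreover have "\<bar>(real (Suc N) * a x - real (k a)) / real (Suc N)\<bar> < 1 / real (Suc N)"
        using k by (simp add: abs_divide divide_strict_right_mono)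
      ultimately show "\<bar>a x - real (k a) / real (Suc N)\<bar> < 1 / real (Suc N)" by simp
    qed
    then have "k \<in> I" "x \<in> U k" using x by (auto simp: I_def U_def fbox_def k_def)
    then show "x \<in> (\<Union>k\<in>I. U k)" by blast
  qed
  obtain W where W: "\<And>k. k \<in> I \<Longrightarrow> openin Z (W k)" "\<And>k. k \<in> I \<Longrightarrow> W k \<subseteq> U k"
    "topspace Z \<subseteq> (\<Union>k\<in>I. W k)"
    "\<And>x. x \<in> topspace Z \<Longrightarrow> int (card {k \<in> I. x \<in> W k}) \<le> n + 1"
    by (rule covering_dim_leE[OF dim finI opU covU]) (rule that; assumption)
  obtain b :: "_ \<Rightarrow> _ \<Rightarrow> real" where b: "\<And>k. k \<in> I \<Longrightarrow> continuous_map Z euclideanreal (b k)"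
    "\<And>k x. k \<in> I \<Longrightarrow> x \<in> topspace Z \<Longrightarrow> 0 \<le> b k x \<and> b k x \<le> 1 \<and> (0 < b k x \<longleftrightarrow> x \<in> W k)"
    "\<And>x. x \<in> topspace Z \<Longrightarrow> \<exists>k\<in>I. b k x = 1"
    by (rule subordinate_functions[OF pn finI W(1) W(3)]) (assumption, (rule that; assumption))
  show ?thesis
  proof (intro exI[of _ "b ` I"] conjI ballI impI)
    show "finite (b ` I)" using finI by simp
    show "b ` I \<subseteq> unit_maps Z"
    proof
      fix f assume "f \<in> b ` I"
      then obtain k where k: "k \<in> I" "f = b k" by blast
      have "f x \<in> {0..1}" if "x \<in> topspace Z" for x using b(2)[OF k(1) that] k(2) by simp
      then show "f \<in> unit_maps Z" using b(1)[OF k(1)] k(2) by (simp add: unit_maps_def)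
    qed
  next
    fix f x y a assume "f \<in> b ` I" and *: "x \<in> topspace Z" "y \<in> topspace Z" "0 < f x" "0 < f y" "a \<in> A"
    then obtain k where k: "k \<in> I" "f = b k" by blast
    have "x \<in> U k" "y \<in> U k" using * b(2)[OF k(1)] k(2) W(2)[OF k(1)] by blast+
    then have "\<bar>a x - real (k a) / real (Suc N)\<bar> < 1 / real (Suc N)"
      "\<bar>a y - real (k a) / real (Suc N)\<bar> < 1 / real (Suc N)" using *(5) by (auto simp: U_def fbox_def)
    then show "\<bar>a x - a y\<bar> \<le> 2 / real (Suc N)" by linarith
  next
    fix x assume x: "x \<in> topspace Z"
    show "\<exists>f\<in>b ` I. f x = 1" using b(3)[OF x] by auto
    have "{f \<in> b ` I. 0 < f x} = b ` {k\<in>I. x \<in> W k}" using b(2)[OF _ x] by auto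
    then have "card {f \<in> b ` I. 0 < f x} \<le> card {k\<in>I. x \<in> W k}" using finI by (simp add: card_image_le)
    then show "int (card {f \<in> b ` I. 0 < f x}) \<le> n + 1" using W(4)[OF x] by linarith
  qed
qed

text \<open>Points that no continuous real function separates are identified, so the values of \<open>R\<close>
  and \<open>S\<close> are only required to be finite up to that identification.\<close>

definition functionally_finite :: "'a topology \<Rightarrow> 'a set \<Rightarrow> bool" where
  "functionally_finite Z A \<longleftrightarrow>
     (\<exists>D. finite D \<and> (\<forall>x\<in>A. \<exists>d\<in>D. \<forall>f. continuous_map Z euclideanreal f \<longrightarrow> f x = f d))"

lemma functionally_finite_image:
  assumes "functionally_finite Z A" and g: "\<And>j. continuous_map Z euclideanreal (g j)"
  shows "finite ((\<lambda>x j. g j x) ` A)"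
proof -
  obtain D where D: "finite D" "\<forall>x\<in>A. \<exists>d\<in>D. \<forall>f. continuous_map Z euclideanreal f \<longrightarrow> f x = f d"
    using assms(1) unfolding functionally_finite_def by blast
  have "(\<lambda>x j. g j x) ` A \<subseteq> (\<lambda>x j. g j x) ` D"
  proof
    fix z assume "z \<in> (\<lambda>x j. g j x) ` A"
    then obtain x where x: "x \<in> A" "z = (\<lambda>j. g j x)" by blast
    obtain d where d: "d \<in> D" "\<forall>f. continuous_map Z euclideanreal f \<longrightarrow> f x = f d" using D(2) x(1) by blast
    have "z = (\<lambda>j. g j d)" using x(2) d(2) g by auto
    then show "z \<in> (\<lambda>x j. g j x) ` D" using d(1) by blast
  qed
  then show ?thesis using D(1) by (meson finite_imageI finite_subset)
qed

lemma perfectly_normal_cozero_unit_maps: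
  assumes "perfectly_normal_space Z" "openin Z U"
  shows "\<exists>u. u \<in> unit_maps Z \<and> (\<forall>x\<in>topspace Z. 0 < u x \<longleftrightarrow> x \<in> U)"
  by (rule perfectly_normal_cozero[OF assms]) (auto simp: unit_maps_def)

text \<open>A countable family of pairs of functions, closed off under the refinements of covers of
  \<open>P\<close> and under both multivalued maps, induces maps of \<open>P\<close> and \<open>Q\<close> into the Hilbert cube whose
  images inherit \<open>R\<close> and \<open>S\<close>, the image of \<open>P\<close> having dimension at most \<open>n\<close>.\<close>

proposition covering_dim_le_transfer:
  fixes P :: "'a topology" and Q :: "'b topology"
  assumes pnP: "perfectly_normal_space P" and pnQ: "perfectly_normal_space Q"
    and R: "\<And>y. y \<in> topspace Q \<Longrightarrow> R y \<subseteq> topspace P" "\<And>y. y \<in> topspace Q \<Longrightarrow> functionally_finite P (R y)"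
    and S: "\<And>x. x \<in> topspace P \<Longrightarrow> S x \<subseteq> topspace Q" "\<And>x. x \<in> topspace P \<Longrightarrow> functionally_finite Q (S x)"
    and lscR: "\<And>U. openin P U \<Longrightarrow> openin Q {y \<in> topspace Q. R y \<inter> U \<noteq> {}}"
    and lscS: "\<And>U. openin Q U \<Longrightarrow> openin P {x \<in> topspace P. S x \<inter> U \<noteq> {}}"
    and mutual: "\<And>y. y \<in> topspace Q \<Longrightarrow> \<exists>x\<in>R y. y \<in> S x"
    and dim: "covering_dim_le P n"
  shows "covering_dim_le Q n"
proof (rule covering_dim_leI)
  fix \<U> assume finU: "finite \<U>" and opU: "\<And>U. U \<in> \<U> \<Longrightarrow> openin Q U" and covU: "topspace Q \<subseteq> \<Union>\<U>"
  have "\<forall>U\<in>\<U>. \<exists>u. u \<in> unit_maps Q \<and> (\<forall>y\<in>topspace Q. 0 < u y \<longleftrightarrow> y \<in> U)"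
    using opU perfectly_normal_cozero_unit_maps[OF pnQ] by blast
  from bchoice[OF this] obtain u where u: "\<forall>U\<in>\<U>. u U \<in> unit_maps Q \<and> (\<forall>y\<in>topspace Q. 0 < u U y \<longleftrightarrow> y \<in> U)"
    by blast
  \<comment> \<open>Pairing lets one enumeration index the coordinates of both images; a function
    wanted on one side only is paired with zero.\<close>
  define W where "W = unit_maps P \<times> unit_maps Q"
  have WP: "a \<in> unit_maps P" if "A \<subseteq> W" "a \<in> fst ` A" for A a using that by (auto simp: W_def)
  have WQ: "a \<in> unit_maps Q" if "A \<subseteq> W" "a \<in> snd ` A" for A a using that by (auto simp: W_def)
  define goodB where "goodB A N B \<longleftrightarrow> finite B \<and> B \<subseteq> unit_maps P \<and>
    (\<forall>x\<in>topspace P. \<exists>b\<in>B. b x = 1) \<and>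
    (\<forall>x\<in>topspace P. int (card {b\<in>B. 0 < b x}) \<le> n + 1) \<and>
    (\<forall>b\<in>B. \<forall>x\<in>topspace P. \<forall>y\<in>topspace P. 0 < b x \<longrightarrow> 0 < b y \<longrightarrow>
      (\<forall>a\<in>fst ` A. \<bar>a x - a y\<bar> \<le> 2 / real (Suc N)))" for A :: "(('a \<Rightarrow> real) \<times> ('b \<Rightarrow> real)) set" and N B
  define B where "B A N = (SOME B. goodB A N B)" for A N
  have B: "goodB A N (B A N)" if A: "finite A" "A \<subseteq> W" for A N
  proof -
    have "\<exists>B. goodB A N B"
      unfolding goodB_def
      by (rule covering_dim_le_small_oscillation[OF pnP dim]) (use A WP[OF A(2)] in auto)
    then show ?thesis unfolding B_def by (rule someI_ex)
  qed
  \<comment> \<open>Lower semicontinuity makes meeting a box an open condition, and perfect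
    normality turns that open set into one new coordinate.\<close>
  define \<psi> where "\<psi> A q N = (SOME u. u \<in> unit_maps Q \<and> (\<forall>y\<in>topspace Q. 0 < u y \<longleftrightarrow>
    y \<in> {y \<in> topspace Q. R y \<inter> (topspace P \<inter> fbox (fst ` A) q N) \<noteq> {}}))"
    for A :: "(('a \<Rightarrow> real) \<times> ('b \<Rightarrow> real)) set" and q N
  have \<psi>: "\<psi> A q N \<in> unit_maps Q \<and> (\<forall>y\<in>topspace Q. 0 < \<psi> A q N y \<longleftrightarrow>
      y \<in> {y \<in> topspace Q. R y \<inter> (topspace P \<inter> fbox (fst ` A) q N) \<noteq> {}})"
    if A: "finite A" "A \<subseteq> W" for A q N
  proof -
    have "openin P (topspace P \<inter> fbox (fst ` A) q N)"
      by (rule openin_fbox) (use A WP[OF A(2)] in \<open>auto simp: unit_maps_def\<close>)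
    from someI_ex[OF perfectly_normal_cozero_unit_maps[OF pnQ lscR[OF this]]]
    show ?thesis unfolding \<psi>_def .
  qed
  define \<phi> where "\<phi> A q N = (SOME u. u \<in> unit_maps P \<and> (\<forall>x\<in>topspace P. 0 < u x \<longleftrightarrow>
    x \<in> {x \<in> topspace P. S x \<inter> (topspace Q \<inter> fbox (snd ` A) q N) \<noteq> {}}))"
    for A :: "(('a \<Rightarrow> real) \<times> ('b \<Rightarrow> real)) set" and q N
  have \<phi>: "\<phi> A q N \<in> unit_maps P \<and> (\<forall>x\<in>topspace P. 0 < \<phi> A q N x \<longleftrightarrow>
      x \<in> {x \<in> topspace P. S x \<inter> (topspace Q \<inter> fbox (snd ` A) q N) \<noteq> {}})"
    if A: "finite A" "A \<subseteq> W" for A q N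
  proof -
    have "openin Q (topspace Q \<inter> fbox (snd ` A) q N)"
      by (rule openin_fbox) (use A WQ[OF A(2)] in \<open>auto simp: unit_maps_def\<close>)
    from someI_ex[OF perfectly_normal_cozero_unit_maps[OF pnP lscS[OF this]]]
    show ?thesis unfolding \<phi>_def .
  qed
  have zero: "(\<lambda>x. 0) \<in> unit_maps P" "(\<lambda>y. 0) \<in> unit_maps Q" by (auto simp: unit_maps_def)
  \<comment> \<open>The first family forces small dimension on the image of \<open>P\<close>; the
    other two make \<open>R\<close> and \<open>S\<close> descend. No refinements are added on the
    side of \<open>Q\<close>, whose dimension is to be inferred.\<close>
  define op where "op A = (\<Union>N. (\<lambda>b. (b, \<lambda>y. 0)) ` B A N)
    \<union> (\<lambda>(q, N). (\<lambda>x. 0, \<psi> A q N)) ` (PiE (fst ` A) (\<lambda>_. \<rat>) \<times> UNIV)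
    \<union> (\<lambda>(q, N). (\<phi> A q N, \<lambda>y. 0)) ` (PiE (snd ` A) (\<lambda>_. \<rat>) \<times> UNIV)" for A
  have op_B: "(b, \<lambda>y. 0) \<in> op A" if "b \<in> B A N" for A b N
    unfolding op_def by (intro UnI1 UN_I[of N] imageI UNIV_I that)
  have op_\<psi>: "(\<lambda>x. 0, \<psi> A q N) \<in> op A" if "q \<in> PiE (fst ` A) (\<lambda>_. \<rat>)" for A q N
    unfolding op_def using that by (intro UnI1 UnI2 image_eqI[of _ _ "(q, N)"]) simp_all
  have op_\<phi>: "(\<phi> A q N, \<lambda>y. 0) \<in> op A" if "q \<in> PiE (snd ` A) (\<lambda>_. \<rat>)" for A q N
    unfolding op_def using that by (intro UnI2 image_eqI[of _ _ "(q, N)"]) simp_all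
  \<comment> \<open>The zero pair keeps the family nonempty, hence enumerable, even for an empty
    cover; the other pairs make the given cover a pullback from the image of
    \<open>Q\<close>.\<close>
  define C0 where "C0 = insert (\<lambda>x::'a. 0::real, \<lambda>y::'b. 0::real) ((\<lambda>U. (\<lambda>x. 0, u U)) ` \<U>)"
  have C0: "countable C0" "C0 \<subseteq> W"
    using finU u zero by (auto simp: C0_def W_def intro: countable_finite)
  have opc: "countable (op A)" if A: "finite A" "A \<subseteq> W" for A
  proof -
    have "finite (B A N)" for N using B[OF A, of N] by (simp add: goodB_def)
    then show ?thesis unfolding op_def using A(1)
      by (intro countable_Un countable_UN countable_image countable_SIGMA countable_PiE)
         (auto intro: countable_finite countable_rat)
  qed
  have opW: "op A \<subseteq> W" if A: "finite A" "A \<subseteq> W" for A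
  proof -
    have "B A N \<subseteq> unit_maps P" for N using B[OF A, of N] by (simp add: goodB_def)
    then show ?thesis using \<psi>[OF A] \<phi>[OF A] zero by (auto simp: op_def W_def)
  qed
  obtain C where C: "countable C" "C0 \<subseteq> C" "C \<subseteq> W" "\<And>A. finite A \<Longrightarrow> A \<subseteq> C \<Longrightarrow> op A \<subseteq> C"
    by (rule countable_closed_off[OF C0 opc opW]) (assumption+, (rule that; assumption))
  define e where "e = from_nat_into C"
  have "C \<noteq> {}" using C(2) by (auto simp: C0_def)
  then have e: "range e = C" unfolding e_def using C(1) by (rule range_from_nat_into)
  define g where "g j = fst (e j)" for j
  define h where "h j = snd (e j)" for j
  have eC: "e j \<in> C" for j using e by blast
  then have gh: "g j \<in> unit_maps P" "h j \<in> unit_maps Q" for j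
    using subsetD[OF C(3) eC[of j]] by (auto simp: g_def h_def W_def mem_Times_iff)
  then have gc: "continuous_map P euclideanreal (g j)" and hc: "continuous_map Q euclideanreal (h j)" for j
    by (simp_all add: unit_maps_def)
  have inC: "\<exists>j. e j = p" if "p \<in> C" for p using that e by blast
  have eJ: "finite (e ` J)" "e ` J \<subseteq> C" "e ` J \<subseteq> W" "fst ` e ` J = g ` J" "snd ` e ` J = h ` J" if "finite J" for J
    using that eC C(3) by (auto simp: g_def h_def image_image)
  define \<Phi> where "\<Phi> = (\<lambda>x j. g j x)"
  define \<Psi> where "\<Psi> = (\<lambda>y j. h j y)"
  have keyR: "\<exists>j. \<forall>y\<in>topspace Q. 0 < h j y \<longleftrightarrow> R y \<inter> fbox (g ` J) q N \<noteq> {}"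
    if J: "finite J" and q: "q \<in> PiE (g ` J) (\<lambda>_. \<rat>)" for J q N
  proof -
    have "(\<lambda>x. 0, \<psi> (e ` J) q N) \<in> C"
      by (rule subsetD[OF C(4)[OF eJ(1,2)[OF J]] op_\<psi>]) (use q eJ(4)[OF J] in simp)
    then obtain j where j: "e j = (\<lambda>x. 0, \<psi> (e ` J) q N)" using inC by blast
    have "0 < h j y \<longleftrightarrow> R y \<inter> fbox (g ` J) q N \<noteq> {}" if y: "y \<in> topspace Q" for y
    proof -
      have "R y \<inter> (topspace P \<inter> fbox (g ` J) q N) = R y \<inter> fbox (g ` J) q N" using R(1)[OF y] by blast
      then show ?thesis using \<psi>[of "e ` J" q N] eJ[OF J] y j by (simp add: h_def)
    qed
    then show ?thesis by blast
  qed
  have keyS: "\<exists>j. \<forall>x\<in>topspace P. 0 < g j x \<longleftrightarrow> S x \<inter> fbox (h ` J) q N \<noteq> {}"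
    if J: "finite J" and q: "q \<in> PiE (h ` J) (\<lambda>_. \<rat>)" for J q N
  proof -
    have "(\<phi> (e ` J) q N, \<lambda>y. 0) \<in> C"
      by (rule subsetD[OF C(4)[OF eJ(1,2)[OF J]] op_\<phi>]) (use q eJ(5)[OF J] in simp)
    then obtain j where j: "e j = (\<phi> (e ` J) q N, \<lambda>y. 0)" using inC by blast
    have "0 < g j x \<longleftrightarrow> S x \<inter> fbox (h ` J) q N \<noteq> {}" if x: "x \<in> topspace P" for x
    proof -
      have "S x \<inter> (topspace Q \<inter> fbox (h ` J) q N) = S x \<inter> fbox (h ` J) q N" using S(1)[OF x] by blast
      then show ?thesis using \<phi>[of "e ` J" q N] eJ[OF J] x j by (simp add: g_def)
    qed
    then show ?thesis by blast
  qed
  have finR: "finite (\<Phi> ` R y)" if "y \<in> topspace Q" for y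
    unfolding \<Phi>_def using functionally_finite_image[OF R(2)[OF that] gc] .
  have finS: "finite (\<Psi> ` S x)" if "x \<in> topspace P" for x
    unfolding \<Psi>_def using functionally_finite_image[OF S(2)[OF that] hc] .
  obtain R' where R': "\<And>y. y \<in> topspace Q \<Longrightarrow> R' (\<Psi> y) = \<Phi> ` R y"
    "\<And>U. open U \<Longrightarrow> openin (top_of_set (\<Psi> ` topspace Q)) {z \<in> \<Psi> ` topspace Q. R' z \<inter> U \<noteq> {}}"
    by (rule lsc_map_image[OF \<Phi>_def \<Psi>_def finR keyR]) (assumption+, (rule that; assumption))
  obtain S' where S': "\<And>x. x \<in> topspace P \<Longrightarrow> S' (\<Phi> x) = \<Psi> ` S x"
    "\<And>U. open U \<Longrightarrow> openin (top_of_set (\<Phi> ` topspace P)) {z \<in> \<Phi> ` topspace P. S' z \<inter> U \<noteq> {}}"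
    by (rule lsc_map_image[OF \<Psi>_def \<Phi>_def finS keyS]) (assumption+, (rule that; assumption))
  have dimP: "covering_dim_le (top_of_set (\<Phi> ` topspace P)) n"
  proof (rule covering_dim_le_Hilbert_cube_subset)
    show "z j \<in> {0..1}" if "z \<in> \<Phi> ` topspace P" for z j
      using that gh(1)[of j] by (auto simp: \<Phi>_def unit_maps_def)
    fix J :: "nat set" and \<epsilon> :: real assume J: "finite J" and "0 < \<epsilon>"
    then obtain N where N: "1 / real (Suc N) < \<epsilon>/2" using nat_approx_posE[of "\<epsilon>/2"] by auto
    let ?B = "B (e ` J) N"
    have good: "goodB (e ` J) N ?B" using B eJ[OF J] by simp
    have "\<forall>b\<in>?B. \<exists>j. e j = (b, \<lambda>y. 0)"
    proof
      fix b assume "b \<in> ?B"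
      then have "(b, \<lambda>y. 0) \<in> C"
        by (rule subsetD[OF C(4)[OF eJ(1,2)[OF J]] op_B])
      then show "\<exists>j. e j = (b, \<lambda>y. 0)" by (rule inC)
    qed
    \<comment> \<open>Closedness under \<open>op\<close> turns each refining function
      \<open>b\<close> into a coordinate \<open>i b\<close>, so the refinement of covers of
      \<open>P\<close> becomes a statement about coordinates.\<close>
    from bchoice[OF this] obtain i where "\<forall>b\<in>?B. e (i b) = (b, \<lambda>y. 0)" by blast
    then have gi: "g (i b) = b" if "b \<in> ?B" for b using that by (simp add: g_def)
    show "\<exists>I. finite I \<and> (\<forall>z\<in>\<Phi> ` topspace P. \<exists>j\<in>I. z j = 1) \<and>
      (\<forall>z\<in>\<Phi> ` topspace P. int (card {j\<in>I. 0 < z j}) \<le> n + 1) \<and>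
      (\<forall>j\<in>I. \<forall>z\<in>\<Phi> ` topspace P. \<forall>z'\<in>\<Phi> ` topspace P. 0 < z j \<longrightarrow> 0 < z' j \<longrightarrow> (\<forall>i\<in>J. \<bar>z i - z' i\<bar> \<le> \<epsilon>))"
    proof (intro exI[of _ "i ` ?B"] conjI ballI impI)
      show "finite (i ` ?B)" using good by (simp add: goodB_def)
    next
      fix z assume "z \<in> \<Phi> ` topspace P"
      then obtain x where x: "x \<in> topspace P" "z = \<Phi> x" by blast
      then obtain b where "b \<in> ?B" "b x = 1" using good by (auto simp: goodB_def)
      then show "\<exists>j\<in>i ` ?B. z j = 1" using gi x by (auto simp: \<Phi>_def)
    next
      fix z assume "z \<in> \<Phi> ` topspace P"
      then obtain x where x: "x \<in> topspace P" "z = \<Phi> x" by blast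
      have "finite ?B" using good by (simp add: goodB_def)
      moreover have "{j\<in>i ` ?B. 0 < z j} = i ` {b\<in>?B. 0 < b x}" using gi x by (auto simp: \<Phi>_def)
      ultimately have "card {j\<in>i ` ?B. 0 < z j} \<le> card {b\<in>?B. 0 < b x}" by (simp add: card_image_le)
      moreover have "int (card {b\<in>?B. 0 < b x}) \<le> n + 1" using good x by (simp add: goodB_def)
      ultimately show "int (card {j\<in>i ` ?B. 0 < z j}) \<le> n + 1" by linarith
    next
      fix j z z' k assume "j \<in> i ` ?B" and z: "z \<in> \<Phi> ` topspace P" "z' \<in> \<Phi> ` topspace P"
        and pos: "0 < z j" "0 < z' j" and k: "k \<in> J"
      then obtain b where b: "b \<in> ?B" "j = i b" by blast
      obtain x x' where x: "x \<in> topspace P" "z = \<Phi> x" "x' \<in> topspace P" "z' = \<Phi> x'" using z by blast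
      have "0 < b x" "0 < b x'" using pos x b gi by (simp_all add: \<Phi>_def)
      moreover have "\<forall>b\<in>?B. \<forall>x\<in>topspace P. \<forall>y\<in>topspace P. 0 < b x \<longrightarrow> 0 < b y \<longrightarrow>
          (\<forall>a\<in>g ` J. \<bar>a x - a y\<bar> \<le> 2 / real (Suc N))"
        using good unfolding goodB_def eJ(4)[OF J] by (elim conjE)
      ultimately have "\<bar>g k x - g k x'\<bar> \<le> 2 / real (Suc N)" using b(1) x(1,3) k by blast
      then show "\<bar>z k - z' k\<bar> \<le> \<epsilon>" using N x by (simp add: \<Phi>_def)
    qed
  qed
  have dimQ: "covering_dim_le (top_of_set (\<Psi> ` topspace Q)) n"
  proof (rule covering_dim_le_transfer_metric[of _ R' _ S'])
    show "R' z \<subseteq> \<Phi> ` topspace P" "finite (R' z)" if z: "z \<in> \<Psi> ` topspace Q" for z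
    proof -
      obtain y where y: "y \<in> topspace Q" "z = \<Psi> y" using z by blast
      show "R' z \<subseteq> \<Phi> ` topspace P" "finite (R' z)"
        unfolding y(2) R'(1)[OF y(1)] using R(1)[OF y(1)] finR[OF y(1)] by (simp_all add: image_mono)
    qed
    show "S' z \<subseteq> \<Psi> ` topspace Q" "finite (S' z)" if z: "z \<in> \<Phi> ` topspace P" for z
    proof -
      obtain x where x: "x \<in> topspace P" "z = \<Phi> x" using z by blast
      show "S' z \<subseteq> \<Psi> ` topspace Q" "finite (S' z)"
        unfolding x(2) S'(1)[OF x(1)] using S(1)[OF x(1)] finS[OF x(1)] by (simp_all add: image_mono)
    qed
    show "\<exists>x\<in>R' z. z \<in> S' x" if "z \<in> \<Psi> ` topspace Q" for z
    proof -
      obtain y where y: "y \<in> topspace Q" "z = \<Psi> y" using \<open>z \<in> _\<close> by blast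
      obtain x where x: "x \<in> R y" "y \<in> S x" using mutual[OF y(1)] by blast
      have "x \<in> topspace P" using R(1)[OF y(1)] x(1) by blast
      then show ?thesis using x y R'(1)[OF y(1)] S'(1) by (intro bexI[of _ "\<Phi> x"]) auto
    qed
  qed (use R'(2) S'(2) dimP in auto)
  \<comment> \<open>The functions \<open>u U\<close> occur among the coordinates, so each
    \<open>U\<close> is the preimage of a half-space, and a shrinking in the image pulls back to a
    refinement of the original cover.\<close>
  have "\<forall>U\<in>\<U>. \<exists>j. e j = (\<lambda>x. 0, u U)"
    using inC C(2) by (auto simp: C0_def)
  from bchoice[OF this] obtain i where "\<forall>U\<in>\<U>. e (i U) = (\<lambda>x. 0, u U)" by blast
  then have hi: "0 < h (i U) y \<longleftrightarrow> y \<in> U" if "U \<in> \<U>" "y \<in> topspace Q" for U y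
    using that u by (simp add: h_def)
  have opV: "openin (top_of_set (\<Psi> ` topspace Q)) (\<Psi> ` topspace Q \<inter> {z. 0 < z (i U)})" for U
    by (intro openin_open_Int open_Collect_less continuous_on_const) simp
  have covV: "topspace (top_of_set (\<Psi> ` topspace Q)) \<subseteq> (\<Union>U\<in>\<U>. \<Psi> ` topspace Q \<inter> {z. 0 < z (i U)})"
  proof
    fix z assume "z \<in> topspace (top_of_set (\<Psi> ` topspace Q))"
    then obtain y where y: "y \<in> topspace Q" "z = \<Psi> y" by auto
    then obtain U where "U \<in> \<U>" "y \<in> U" using covU by blast
    then show "z \<in> (\<Union>U\<in>\<U>. \<Psi> ` topspace Q \<inter> {z. 0 < z (i U)})" using y hi by (auto simp: \<Psi>_def)
  qed
  obtain V where V: "\<And>U. U \<in> \<U> \<Longrightarrow> openin (top_of_set (\<Psi> ` topspace Q)) (V U)"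
    "\<And>U. U \<in> \<U> \<Longrightarrow> V U \<subseteq> \<Psi> ` topspace Q \<inter> {z. 0 < z (i U)}"
    "\<Psi> ` topspace Q \<subseteq> (\<Union>U\<in>\<U>. V U)"
    "\<And>z. z \<in> \<Psi> ` topspace Q \<Longrightarrow> int (card {U \<in> \<U>. z \<in> V U}) \<le> n + 1"
    by (rule covering_dim_leE[OF dimQ finU opV covV, unfolded topspace_euclidean_subtopology])
       (rule that; assumption)
  have "continuous_map Q (product_topology (\<lambda>_. euclideanreal) UNIV) \<Psi>"
    using hc by (simp add: continuous_map_componentwise_UNIV \<Psi>_def)
  then have \<Psi>c: "continuous_map Q (top_of_set (\<Psi> ` topspace Q)) \<Psi>"
    by (simp add: euclidean_product_topology continuous_map_in_subtopology)
  show "\<exists>(J::'b set set) W. finite J \<and> (\<forall>j\<in>J. openin Q (W j) \<and> (\<exists>U\<in>\<U>. W j \<subseteq> U)) \<and>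
      topspace Q \<subseteq> (\<Union>j\<in>J. W j) \<and> (\<forall>y\<in>topspace Q. int (card {j\<in>J. y \<in> W j}) \<le> n + 1)"
  proof (intro exI conjI ballI)
    show "openin Q {y \<in> topspace Q. \<Psi> y \<in> V U}" if "U \<in> \<U>" for U
      using openin_continuous_map_preimage[OF \<Psi>c V(1)[OF that]] .
    show "\<exists>U'\<in>\<U>. {y \<in> topspace Q. \<Psi> y \<in> V U} \<subseteq> U'" if U: "U \<in> \<U>" for U
    proof (intro bexI[OF _ U] subsetI)
      fix y assume "y \<in> {y \<in> topspace Q. \<Psi> y \<in> V U}"
      then have "y \<in> topspace Q" "0 < \<Psi> y (i U)" using V(2)[OF U] by auto
      then show "y \<in> U" using hi[OF U] by (simp add: \<Psi>_def)
    qed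
    show "topspace Q \<subseteq> (\<Union>U\<in>\<U>. {y \<in> topspace Q. \<Psi> y \<in> V U})"
      using V(3) by auto
    fix y assume y: "y \<in> topspace Q"
    then show "int (card {U\<in>\<U>. y \<in> {y \<in> topspace Q. \<Psi> y \<in> V U}}) \<le> n + 1"
      using V(4)[of "\<Psi> y"] by simp
  qed (rule finU)
qed

section \<open>Coefficients with respect to a Hamel basis\<close>

text \<open>A basis need not be \<open>T\<^sub>1\<close>: basis elements with the same image under all continuous linear
  functionals are topologically indistinguishable, and only the sum of the coefficients over such a
  class is meaningful.\<close>

definition same_values :: "('a \<Rightarrow> real) set \<Rightarrow> 'a \<Rightarrow> 'a set" where
  "same_values F y = {z. \<forall>f\<in>F. f z = f y}"

definition class_coeff :: "'a::real_vector set \<Rightarrow> ('a \<Rightarrow> real) set \<Rightarrow> 'a \<Rightarrow> 'a \<Rightarrow> real" where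
  "class_coeff N F y = construct N (\<lambda>z. if z \<in> same_values F y then 1 else 0)"

text \<open>With \<open>y\<close> the support contains every member of \<open>N\<close> in the same
  class, so it can be infinite; this is why finiteness is asked only up to identification.\<close>

definition class_supp :: "'a::real_vector set \<Rightarrow> ('a \<Rightarrow> real) set \<Rightarrow> 'a \<Rightarrow> 'a set" where
  "class_supp N F x = {y \<in> N. class_coeff N F y x \<noteq> 0}"

lemma linear_class_coeff: "independent N \<Longrightarrow> linear (class_coeff N F y)"
  unfolding class_coeff_def by (rule linear_construct)

lemma class_coeff_basis:
  "independent N \<Longrightarrow> d \<in> N \<Longrightarrow> class_coeff N F y d = (if d \<in> same_values F y then 1 else 0)"
  unfolding class_coeff_def by (rule construct_basis)

lemma class_coeff_sum:
  assumes "independent N" "finite D" "D \<subseteq> N"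
  shows "class_coeff N F y (\<Sum>d\<in>D. c d *\<^sub>R d) = (\<Sum>d\<in>D \<inter> same_values F y. c d)"
proof -
  have "class_coeff N F y (\<Sum>d\<in>D. c d *\<^sub>R d) = (\<Sum>d\<in>D. c d * class_coeff N F y d)"
    using linear_class_coeff[OF assms(1)] by (simp add: linear_sum linear_scale)
  also have "\<dots> = (\<Sum>d\<in>D. if d \<in> same_values F y then c d else 0)"
    using assms by (intro sum.cong) (auto simp: class_coeff_basis subsetD)
  also have "\<dots> = (\<Sum>d\<in>D \<inter> same_values F y. c d)"
    using assms(2) by (simp add: sum.inter_restrict)
  finally show ?thesis .
qed

text \<open>Terms are grouped by class. As \<open>g\<close> is constant on a class, the block of
  \<open>d\<close> contributes its class coefficient times \<open>g d\<close>.\<close>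

lemma sum_eq_0_if_class_coeff:
  assumes N: "independent N" and D: "finite D" "D \<subseteq> N"
    and g: "\<And>d d'. d \<in> D \<Longrightarrow> d' \<in> D \<Longrightarrow> d' \<in> same_values F d \<Longrightarrow> g d' = (g d :: real)"
    and 0: "\<And>d. d \<in> D \<Longrightarrow> class_coeff N F d (\<Sum>d\<in>D. c d *\<^sub>R d) * g d = 0"
  shows "(\<Sum>d\<in>D. c d * g d) = 0"
proof -
  have "(\<Sum>d\<in>D. c d * g d) = (\<Sum>K\<in>same_values F ` D. \<Sum>d\<in>{d \<in> D. same_values F d = K}. c d * g d)"
    by (rule sum.image_gen[OF D(1)])
  also have "\<dots> = 0"
  proof (rule sum.neutral, intro ballI)
    fix K assume "K \<in> same_values F ` D"
    then obtain e where e: "e \<in> D" "K = same_values F e" by blast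
    have eq: "{d \<in> D. same_values F d = K} = D \<inter> same_values F e"
      unfolding e(2) by (auto simp: same_values_def)
    have "(\<Sum>d\<in>D \<inter> same_values F e. c d * g d) = (\<Sum>d\<in>D \<inter> same_values F e. c d * g e)"
      using g e(1) by (intro sum.cong) auto
    also have "\<dots> = class_coeff N F e (\<Sum>d\<in>D. c d *\<^sub>R d) * g e"
      by (simp add: class_coeff_sum[OF N D] sum_distrib_right)
    also have "\<dots> = 0" by (rule 0[OF e(1)])
    finally show "(\<Sum>d\<in>{d \<in> D. same_values F d = K}. c d * g d) = 0" by (simp only: eq)
  qed
  finally show ?thesis .
qed

text \<open>The family \<open>F\<close> is a parameter so that two bases can share it and hence the
  same notion of class.\<close>

locale separating_basis =
  fixes T :: "'a::real_vector topology" and F :: "('a \<Rightarrow> real) set" and N :: "'a set"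
  assumes F: "\<And>f. f \<in> F \<Longrightarrow> linear f" "\<And>f. f \<in> F \<Longrightarrow> continuous_map T euclideanreal f"
    and N: "independent N" "span N = UNIV" and T: "topspace T = UNIV"
    and sep: "\<And>A x. closedin (subtopology T N) A \<Longrightarrow> x \<in> N - A \<Longrightarrow> \<exists>f\<in>F. f ` A \<subseteq> {0} \<and> f x \<noteq> 0"
begin

lemma topspace_N [simp]: "topspace (subtopology T N) = N"
  using T by simp

lemma continuous_map_N: "f \<in> F \<Longrightarrow> continuous_map (subtopology T N) euclideanreal f"
  using F(2) by (rule continuous_map_from_subtopology)

lemma expansion: obtains D c where "finite D" "D \<subseteq> N" "x = (\<Sum>d\<in>D. c d *\<^sub>R d)"
proof -
  have "x \<in> span N" using N(2) by simp
  then show thesis using that unfolding span_explicit by blast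
qed

text \<open>Only finitely many basis vectors occur in \<open>x\<close>. A functional vanishing on
  those outside the class of \<open>y\<close>, and off \<open>V\<close>, reads off the class
  coefficient of \<open>x\<close> up to the factor \<open>f y\<close>.\<close>

lemma isolating_functional:
  assumes y: "y \<in> V" and V: "openin (subtopology T N) V"
  obtains f where "f \<in> F" "f ` (N - V) \<subseteq> {0}" "f y \<noteq> 0" "f x = class_coeff N F y x * f y"
proof -
  obtain D c where D: "finite D" "D \<subseteq> N" and x: "x = (\<Sum>d\<in>D. c d *\<^sub>R d)" by (rule expansion)
  have yN: "y \<in> N" using openin_subset[OF V] y by auto
  have "\<forall>d\<in>D - same_values F y. \<exists>h. h \<in> F \<and> h d \<noteq> h y" by (auto simp: same_values_def)
  from bchoice[OF this] obtain h where h: "\<forall>d\<in>D - same_values F y. h d \<in> F \<and> h d d \<noteq> h d y" by blast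
  \<comment> \<open>Without T1 the singleton of \<open>d\<close> need not be closed; the level set
    of \<open>h d\<close> through \<open>d\<close> is, and it avoids \<open>y\<close>.\<close>
  define A where "A = (N - V) \<union> (\<Union>d\<in>D - same_values F y. {z \<in> N. h d z \<in> {h d d}})"
  have "closedin (subtopology T N) {z \<in> N. h d z \<in> {h d d}}" if "d \<in> D - same_values F y" for d
    using closedin_continuous_map_preimage[OF continuous_map_N[of "h d"], of "{h d d}"] h that by (simp add: T)
  moreover have "closedin (subtopology T N) (N - V)"
    using closedin_diff[OF closedin_topspace V] by (simp add: T)
  ultimately have "closedin (subtopology T N) A"
    unfolding A_def using D(1) by (intro closedin_Un closedin_Union) auto
  moreover have "y \<notin> A"
  proof
    assume "y \<in> A"
    then obtain d where "d \<in> D - same_values F y" "h d y = h d d" using y by (auto simp: A_def)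
    then show False using h by metis
  qed
  then have "y \<in> N - A" using yN by simp
  ultimately obtain f where f: "f \<in> F" "f ` A \<subseteq> {0}" "f y \<noteq> 0" using sep by blast
  have fd: "f d = (if d \<in> same_values F y then f y else 0)" if "d \<in> D" for d
  proof (cases "d \<in> same_values F y")
    case True
    then show ?thesis using f(1) by (simp add: same_values_def)
  next
    case False
    then have "d \<in> A" using that D(2) by (auto simp: A_def)
    then show ?thesis using False f(2) by auto
  qed
  have "f x = (\<Sum>d\<in>D. c d * f d)"
    using F(1)[OF f(1)] by (simp add: x linear_sum linear_scale)
  also have "\<dots> = (\<Sum>d\<in>D. if d \<in> same_values F y then c d * f y else 0)"
    by (intro sum.cong refl) (simp add: fd)
  also have "\<dots> = (\<Sum>d\<in>D \<inter> same_values F y. c d * f y)"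
    using D(1) by (simp add: sum.inter_restrict)
  also have "\<dots> = class_coeff N F y x * f y"
    by (simp add: x class_coeff_sum[OF N(1) D] sum_distrib_right)
  finally have "f x = class_coeff N F y x * f y" .
  moreover have "f ` (N - V) \<subseteq> {0}" using f(2) by (auto simp: A_def)
  ultimately show thesis using that f by blast
qed

text \<open>If the support misses \<open>V\<close>, each class block of \<open>f x\<close> vanishes:
  a vector in \<open>V\<close> has class coefficient 0, one outside \<open>V\<close> has
  \<open>f d = 0\<close>.\<close>

lemma class_supp_meets_if_nonzero:
  assumes f: "f \<in> F" "f ` (N - V) \<subseteq> {0}" "f x \<noteq> 0"
  shows "class_supp N F x \<inter> V \<noteq> {}"
proof
  assume 0: "class_supp N F x \<inter> V = {}"
  obtain D c where D: "finite D" "D \<subseteq> N" and x: "x = (\<Sum>d\<in>D. c d *\<^sub>R d)" by (rule expansion)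
  have "(\<Sum>d\<in>D. c d * f d) = 0"
  proof (rule sum_eq_0_if_class_coeff[OF N(1) D, where F = F])
    show "f d' = f d" if "d' \<in> same_values F d" for d d' using that f(1) by (simp add: same_values_def)
    show "class_coeff N F d (\<Sum>d\<in>D. c d *\<^sub>R d) * f d = 0" if "d \<in> D" for d
      using that D(2) f(2) 0 unfolding x[symmetric] by (cases "d \<in> V") (auto simp: class_supp_def)
  qed
  moreover have "f x = (\<Sum>d\<in>D. c d * f d)"
    using F(1)[OF f(1)] by (simp add: x linear_sum linear_scale)
  ultimately show False using f(3) by simp
qed

text \<open>The isolating functional depends on the vector it is applied to, so it is taken for the
  difference \<open>x' - x\<close>, on which all of \<open>F\<close> vanishes.\<close>

lemma class_coeff_cong:
  assumes "y \<in> N" "x' \<in> same_values F x"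
  shows "class_coeff N F y x' = class_coeff N F y x"
proof -
  have "openin (subtopology T N) N" using openin_topspace[of "subtopology T N"] by (simp add: T)
  from isolating_functional[OF assms(1) this]
  obtain f where f: "f \<in> F" "f y \<noteq> 0" "f (x' - x) = class_coeff N F y (x' - x) * f y"
    by metis
  have "f (x' - x) = 0" using assms(2) F(1)[OF f(1)] f(1) by (simp add: linear_diff same_values_def)
  then have "class_coeff N F y (x' - x) = 0" using f by simp
  then show ?thesis using linear_class_coeff[OF N(1)] by (simp add: linear_diff)
qed

text \<open>A functional isolating \<open>y\<close> in the support of \<open>x\<close> is nonzero at
  \<open>x\<close>, hence on a neighbourhood, and wherever it is nonzero the support still meets
  \<open>V\<close>.\<close>

lemma class_supp_lsc:
  assumes V: "openin (subtopology T N) V"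
  shows "openin (subtopology T M) {x \<in> M. class_supp N F x \<inter> V \<noteq> {}}"
proof (subst openin_subopen, intro ballI)
  fix x assume "x \<in> {x \<in> M. class_supp N F x \<inter> V \<noteq> {}}"
  then obtain y where x: "x \<in> M" and y: "y \<in> V" "class_coeff N F y x \<noteq> 0" by (auto simp: class_supp_def)
  obtain f where f: "f \<in> F" "f ` (N - V) \<subseteq> {0}" "f y \<noteq> 0" "f x = class_coeff N F y x * f y"
    by (rule isolating_functional[OF y(1) V])
  have "openin (subtopology T M) {x \<in> topspace (subtopology T M). f x \<in> - {0}}"
    by (rule openin_continuous_map_preimage[OF continuous_map_from_subtopology[OF F(2)[OF f(1)]]]) auto
  moreover have "x \<in> {x \<in> topspace (subtopology T M). f x \<in> - {0}}"
    using x y f T by simp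
  moreover have "{x \<in> topspace (subtopology T M). f x \<in> - {0}} \<subseteq> {x \<in> M. class_supp N F x \<inter> V \<noteq> {}}"
    using class_supp_meets_if_nonzero[OF f(1,2)] by auto
  ultimately show "\<exists>U. openin (subtopology T M) U \<and> x \<in> U \<and> U \<subseteq> {x \<in> M. class_supp N F x \<inter> V \<noteq> {}}"
    by blast
qed

text \<open>Every \<open>y\<close> in the support shares its class with some \<open>d\<close> in
  \<open>D\<close>. If a continuous \<open>g\<close> on \<open>N\<close> told them apart,
  \<open>sep\<close> applied to the level set of \<open>g\<close> through \<open>d\<close> would
  give a member of \<open>F\<close> doing so too.\<close>

lemma functionally_finite_class_supp: "functionally_finite (subtopology T N) (class_supp N F x)"
proof -
  obtain D c where D: "finite D" "D \<subseteq> N" and x: "x = (\<Sum>d\<in>D. c d *\<^sub>R d)" by (rule expansion)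
  have "\<exists>d\<in>D. \<forall>g. continuous_map (subtopology T N) euclideanreal g \<longrightarrow> g y = g d"
    if "y \<in> class_supp N F x" for y
  proof -
    have y: "y \<in> N" "(\<Sum>d\<in>D \<inter> same_values F y. c d) \<noteq> 0"
      using that by (simp_all add: class_supp_def x class_coeff_sum[OF N(1) D])
    then obtain d where d: "d \<in> D" "d \<in> same_values F y" by (metis Int_emptyI sum.empty)
    have "g y = g d" if g: "continuous_map (subtopology T N) euclideanreal g" for g :: "'a \<Rightarrow> real"
    proof (rule ccontr)
      assume "g y \<noteq> g d"
      have "closedin (subtopology T N) {z \<in> N. g z \<in> {g d}}"
        using closedin_continuous_map_preimage[OF g, of "{g d}"] by (simp add: T)
      moreover have "y \<in> N - {z \<in> N. g z \<in> {g d}}" using y(1) \<open>g y \<noteq> g d\<close> by simp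
      ultimately obtain f where "f \<in> F" "f ` {z \<in> N. g z \<in> {g d}} \<subseteq> {0}" "f y \<noteq> 0"
        using sep by blast
      moreover have "d \<in> {z \<in> N. g z \<in> {g d}}" using d(1) D(2) by auto
      ultimately show False using d(2) by (fastforce simp: same_values_def)
    qed
    then show ?thesis using d(1) by blast
  qed
  then show ?thesis unfolding functionally_finite_def using D(1) by blast
qed

end

section \<open>Comparing two bases\<close>

text \<open>Expanding \<open>y\<close> in \<open>M\<close> and applying its own class coefficient
  with respect to \<open>N\<close> gives 1. If no \<open>x\<close> worked, each class block of the
  expansion would have one of its two factors zero.\<close>

lemma class_supp_mutual:
  assumes M: "separating_basis T F M" and N: "separating_basis T F N" and y: "y \<in> N"
  shows "\<exists>x\<in>class_supp M F y. y \<in> class_supp N F x"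
proof (rule ccontr)
  interpret M: separating_basis T F M by (rule M)
  interpret N: separating_basis T F N by (rule N)
  assume neg: "\<not> ?thesis"
  obtain D c where D: "finite D" "D \<subseteq> M" and yD: "y = (\<Sum>d\<in>D. c d *\<^sub>R d)" by (rule M.expansion)
  have "(\<Sum>d\<in>D. c d * class_coeff N F y d) = 0"
  proof (rule sum_eq_0_if_class_coeff[OF M.N(1) D, where F = F])
    show "class_coeff N F y d' = class_coeff N F y d" if "d' \<in> same_values F d" for d d'
      using N.class_coeff_cong[OF y that] .
    show "class_coeff M F d (\<Sum>d\<in>D. c d *\<^sub>R d) * class_coeff N F y d = 0" if "d \<in> D" for d
      using neg that D(2) y unfolding yD[symmetric] by (auto simp: class_supp_def)
  qed
  \<comment> \<open>Only the argument is expanded in \<open>M\<close>; the \<open>y\<close> naming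
    the class stays, hence the selected occurrence.\<close>
  moreover have "class_coeff N F y y = (\<Sum>d\<in>D. c d * class_coeff N F y d)"
    using linear_class_coeff[OF N.N(1), of F y]
    by (subst (2) yD) (simp add: linear_sum linear_scale)
  moreover have "class_coeff N F y y = 1"
    using class_coeff_basis[OF N.N(1) y] by (simp add: same_values_def)
  ultimately show False by simp
qed

lemma covering_dim_le_separating_basis:
  assumes M: "separating_basis T F M" and N: "separating_basis T F N"
    and pn: "perfectly_normal_space (subtopology T M)" "perfectly_normal_space (subtopology T N)"
    and dim: "covering_dim_le (subtopology T M) n"
  shows "covering_dim_le (subtopology T N) n"
proof -
  interpret M: separating_basis T F M by (rule M)
  interpret N: separating_basis T F N by (rule N)
  show ?thesis
  proof (rule covering_dim_le_transfer[OF pn, of "class_supp M F" "class_supp N F"])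
    show "class_supp M F y \<subseteq> topspace (subtopology T M)" "class_supp N F y \<subseteq> topspace (subtopology T N)" for y
      by (auto simp: class_supp_def M.T)
    show "functionally_finite (subtopology T M) (class_supp M F y)"
      "functionally_finite (subtopology T N) (class_supp N F y)" for y
      by (rule M.functionally_finite_class_supp N.functionally_finite_class_supp)+
    show "openin (subtopology T N) {y \<in> topspace (subtopology T N). class_supp M F y \<inter> U \<noteq> {}}"
      if "openin (subtopology T M) U" for U
      using M.class_supp_lsc[OF that] by (simp add: M.T)
    show "openin (subtopology T M) {x \<in> topspace (subtopology T M). class_supp N F x \<inter> U \<noteq> {}}"
      if "openin (subtopology T N) U" for U
      using N.class_supp_lsc[OF that] by (simp add: M.T)
    show "\<exists>x\<in>class_supp M F y. y \<in> class_supp N F x" if "y \<in> topspace (subtopology T N)" for y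
      using class_supp_mutual[OF M N] that by simp
  qed (rule dim)
qed

theorem theorem4p3:
  fixes T :: "'a::real_vector topology" and M :: "nat \<Rightarrow> 'a set"
  assumes "topspace T = UNIV"
    and "\<And>i. i \<in> {0, 1} \<Longrightarrow> independent (M i) \<and> span (M i) = UNIV"
    and "\<And>i. i \<in> {0, 1} \<Longrightarrow> perfectly_normal_space (subtopology T (M i))"
    and "\<And>i A x. i \<in> {0, 1} \<Longrightarrow> closedin (subtopology T (M i)) A \<Longrightarrow> x \<in> M i - A \<Longrightarrow>
           \<exists>f :: 'a \<Rightarrow> real. linear f \<and> continuous_map T euclideanreal f \<and> f ` A \<subseteq> {0} \<and> f x \<noteq> 0"
  shows "covering_dim (subtopology T (M 0)) = covering_dim (subtopology T (M 1))"
proof -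
  define F where "F = {f :: 'a \<Rightarrow> real. linear f \<and> continuous_map T euclideanreal f}"
  have sb: "separating_basis T F (M i)" if i: "i \<in> {0, 1}" for i
  proof (rule separating_basis.intro)
    show "\<exists>f\<in>F. f ` A \<subseteq> {0} \<and> f x \<noteq> 0"
      if "closedin (subtopology T (M i)) A" "x \<in> M i - A" for A x
      using assms(4)[OF i that] unfolding F_def by blast
  qed (use assms(1) assms(2)[OF i] in \<open>auto simp: F_def\<close>)
  have le: "covering_dim_le (subtopology T (M j)) n"
    if i: "i \<in> {0, 1}" and j: "j \<in> {0, 1}" and dim: "covering_dim_le (subtopology T (M i)) n" for i j n
    by (rule covering_dim_le_separating_basis[OF sb[OF i] sb[OF j] assms(3)[OF i] assms(3)[OF j] dim])
  have "covering_dim_le (subtopology T (M 0)) n \<longleftrightarrow> covering_dim_le (subtopology T (M 1)) n" for n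
    using le[of 0 1 n] le[of 1 0 n] by auto
  then show ?thesis by (simp add: covering_dim_def)
qed

end
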